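(* In the setting described in the context, suppose that $b\in\mathbb{R}^{L(L-1)}$ is a noiseless voltage measurement corresponding to a positive conductivity $\sigma^*=\sigma_0+\sum_{\nu=1}^n\xi^*_\nu\chi_\nu$, i.e. $b=F(\xi^* )$. Let $\omega>0$, $\vartheta_j>0$ $(1\le j\le N)$, $\beta>\tfrac32$, $\eta=\beta-\tfrac32>0$, and let $$G(\zeta,\theta)=\frac1{2\omega^2}\big\|b-F(\mathsf{L}^\dagger\zeta)\big\|^2+\frac12\sum_{j=1}^N\frac{\zeta_j^2}{\theta_j}+\sum_{j=1}^N\frac{\theta_j}{\vartheta_j}-\eta\sum_{j=1}^N\log\frac{\theta_j}{\vartheta_j}$$ be the Gibbs energy with $r=1$. Then a sufficient condition for $G$ to be convex is $\xi_\nu\le\xi^*_\nu$ for $1\le\nu\le n$, where $\xi=\mathsf{L}^\dagger\zeta$; that is, $G$ is convex on the convex set $$\big\{(\zeta,\theta)\in\mathbb{R}^N\times(0,\infty)^N:\ -\sigma_0<(\mathsf{L}^\dagger\zeta)_\nu\le\xi^*_\nu,\ 1\le\nu\le n\big\}.$$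
   Context: Geometry and mesh. $\Omega\subset\mathbb{R}^2$ is a bounded connected polygonal domain with connected complement, with a conforming triangular tessellation $\{K_\nu\}_{\nu=1}^{n_t}$ having $n_v$ vertices $p_k$ and piecewise linear Lagrange basis functions $\psi_1,\dots,\psi_{n_v}$, $\psi_j(p_k)=\delta_{jk}$. $\chi_\nu$ is the characteristic function of $K_\nu$. $D\subset\Omega$ is a compact set that is a union of closed triangles, $D=\bigcup_{\nu=1}^n\overline{K_\nu}$ with $n<n_t$. On $\partial\Omega$ there are $L\ge 2$ non-overlapping electrodes $E_1,\dots,E_L\subset\partial\Omega$ (nondegenerate intervals of the boundary curve) with known contact impedances $z_\ell>0$. The constant $\sigma_0>0$ is known. Forward map. For a conductivity $\sigma$ bounded between two positive constants, define on $H^1(\Omega)\times\mathbb{R}^L_0$, where $\mathbb{R}^L_0=\{U\in\mathbb{R}^L:\sum_\ell U_\ell=0\}$, the bilinear form $$\mathscr{B}_{\sigma,z}\big((u,U),(v,V)\big)=\int_\Omega\sigma\nabla u\cdot\nabla v\,dx+\sum_{\ell=1}^L\frac1{z_\ell}\int_{E_\ell}(u-U_\ell)(v-V_\ell)\,dS.$$ Let $\mathcal{E}_1,\dots,\mathcal{E}_{L-1}$ be an orthonormal basis of $\mathbb{R}^L_0$ and $\mathsf{E}=[\mathcal{E}_1\ \cdots\ \mathcal{E}_{L-1}]\in\mathbb{R}^{L\times(L-1)}$. Put $\overline\psi_j=(\psi_j,0)$ for $1\le j\le n_v$ and $\overline\psi_{n_v+\ell}=(0,\mathcal{E}_\ell)$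 for $1\le\ell\le L-1$, and let $\mathsf{K}_\sigma\in\mathbb{R}^{(n_v+L-1)\times(n_v+L-1)}$ have entries $\mathscr{B}_{\sigma,z}(\overline\psi_j,\overline\psi_k)$; it is symmetric positive definite. The applied current patterns are $I^\ell=\mathcal{E}_\ell$, $1\le\ell\le L-1$. For $\xi\in\mathbb{R}^n$ with $\sigma_0+\xi_\nu>0$, $1\le\nu\le n$, put $\sigma=\sigma_0+\sum_{\nu=1}^n\xi_\nu\chi_\nu$ and $$\alpha(\xi)=[\mathsf{O}^{\mathsf T}\ \ \mathsf{I}_{L-1}]\,\mathsf{K}_\sigma^{-1}\begin{bmatrix}\mathsf{O}\\ \mathsf{I}_{L-1}\end{bmatrix}\in\mathbb{R}^{(L-1)\times(L-1)},$$ with $\mathsf O$ the $n_v\times(L-1)$ zero matrix. The forward map $F(\xi)\in\mathbb{R}^{L(L-1)}$ is the vector obtained by stacking the columns of $\mathsf{E}\,\alpha(\xi)$ (the electrode voltage vectors in response to $I^1,\dots,I^{L-1}$). Increment matrix. Let $\epsilon_1,\dots,\epsilon_N$ be the mesh edges $\epsilon_\ell=\overline{K_\nu}\cap\overline{K_\mu}$ shared by two triangles at least one of which is contained in $D$, each with an arbitrary orientation (ordering $(\nu,\mu)$ of its two triangles). The matrix $\mathsf{L}\in\mathbb{R}^{N\times n}$ has in its $\ell$-th row the entry $+1$ in column $\nu$ if $K_\nu\subset D$, the entry $-1$ in column $\mu$ if $K_\mu\subset D$, and zeros elsewhere. It has rank $n<N$, and $\mathsf{L}^\dagger=(\mathsf{L}^{\mathsf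 T}\mathsf{L})^{-1}\mathsf{L}^{\mathsf T}$ is its pseudoinverse. The Gibbs energy $G$ is the negative log-posterior (up to an additive constant) for the observation model $b=F(\mathsf{L}^\dagger\zeta)+\varepsilon$ with scaled white Gaussian noise $\varepsilon\sim\mathcal{N}(0,\omega^2\mathsf{I})$, conditionally Gaussian prior $\zeta_j\mid\theta_j\sim\mathcal{N}(0,\theta_j)$ and gamma hyperprior with shape $\beta$ and scales $\vartheta_j$ on $\theta_j$. $\|\cdot\|$ is the Euclidean norm. *)

theory Defs
  imports "HOL-Analysis.Analysis"
begin

type_synonym plane = "real ^ 2"

definition polygonal_path :: "(real \<Rightarrow> plane) \<Rightarrow> bool" where
  "polygonal_path g \<longleftrightarrow> path g \<and>
     (\<exists>S. finite S \<and>
        (\<forall>a b. 0 \<le> a \<and> a < b \<and> b \<le> 1 \<and> {a<..<b} \<inter> S = {} \<longrightarrow>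
           (\<forall>t\<in>{0..1}. g (linepath a b t) = linepath (g a) (g b) t)))"

(* g parametrizes the boundary curve once around. *)
definition polygonal_domain :: "plane set \<Rightarrow> (real \<Rightarrow> plane) \<Rightarrow> bool" where
  "polygonal_domain \<Omega> g \<longleftrightarrow>
     open \<Omega> \<and> bounded \<Omega> \<and> connected \<Omega> \<and> connected (- \<Omega>) \<and>
     polygonal_path g \<and> simple_path g \<and> pathfinish g = pathstart g \<and>
     path_image g = frontier \<Omega>"

(* The K \<nu> are open triangles; p enumerates the mesh vertices without repetition. The
   library's triangulation predicate demands that any two of the closed triangles meet in a
   common (possibly empty) face, i.e. that there are no hanging nodes. *)
definition conforming_mesh ::
    "plane set \<Rightarrow> ('t::finite \<Rightarrow> plane set) \<Rightarrow> ('v::finite \<Rightarrow> plane) \<Rightarrow> bool" where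
  "conforming_mesh \<Omega> K p \<longleftrightarrow>
     inj K \<and> (\<forall>\<nu>. \<exists>T. 2 simplex T \<and> K \<nu> = interior T) \<and>
     triangulation (range (\<lambda>\<nu>. closure (K \<nu>))) \<and>
     closure \<Omega> = (\<Union>\<nu>. closure (K \<nu>)) \<and>
     bij_betw p UNIV {x. \<exists>\<nu>. x extreme_point_of closure (K \<nu>)}"

(* Continuity across the edges is automatic; the values off the closed triangles are irrelevant. *)
definition lagrange_basis ::
    "('t \<Rightarrow> plane set) \<Rightarrow> ('v \<Rightarrow> plane) \<Rightarrow> ('v \<Rightarrow> plane \<Rightarrow> real) \<Rightarrow> bool" where
  "lagrange_basis K p \<psi> \<longleftrightarrow>
     (\<forall>j \<nu>. \<exists>a c. \<forall>x\<in>closure (K \<nu>). \<psi> j x = a \<bullet> x + c) \<and>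
     (\<forall>j k. \<psi> j (p k) = (if j = k then 1 else 0))"

(* A nondegenerate interval (open, closed or half-open) of the closed curve g; shiftpath moves
   the base point, so that intervals running across g 0 are included. *)
definition curve_interval :: "(real \<Rightarrow> plane) \<Rightarrow> plane set \<Rightarrow> bool" where
  "curve_interval g A \<longleftrightarrow>
     (\<exists>s\<in>{0..1}. \<exists>J\<subseteq>{0..1}. is_interval J \<and> interior J \<noteq> {} \<and> A = shiftpath s g ` J)"

(* Two intervals of a curve that share at most end points have a finite intersection. *)
definition electrodes :: "(real \<Rightarrow> plane) \<Rightarrow> ('l \<Rightarrow> plane set) \<Rightarrow> bool" where
  "electrodes g E \<longleftrightarrow>
     (\<forall>l. curve_interval g (E l)) \<and> (\<forall>l m. l \<noteq> m \<longrightarrow> finite (E l \<inter> E m))"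

definition orthonormal_basis_mean_free :: "('m \<Rightarrow> real ^ 'l) \<Rightarrow> bool" where
  "orthonormal_basis_mean_free \<E> \<longleftrightarrow>
     (\<forall>i j. \<E> i \<bullet> \<E> j = (if i = j then 1 else 0)) \<and>
     span (range \<E>) = {U. (\<Sum>l\<in>UNIV. U $ l) = 0}"

definition gradient :: "(plane \<Rightarrow> real) \<Rightarrow> plane \<Rightarrow> plane" where
  "gradient u x = (\<chi> i. frechet_derivative u (at x) (axis i 1))"

(* Integral of f over the part A of the curve g with respect to arc length. *)
definition arclength_integral ::
    "(real \<Rightarrow> plane) \<Rightarrow> plane set \<Rightarrow> (plane \<Rightarrow> real) \<Rightarrow> real" where
  "arclength_integral g A f =
     (LINT t:{t\<in>{0..1}. g t \<in> A}|lebesgue. f (g t) * norm (vector_derivative g (at t)))"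

(* The form is written with the pointwise gradient and pointwise boundary values. It is evaluated
   only at continuous, piecewise affine first components: these are H1 functions whose weak
   gradient is the pointwise one outside the mesh edges, a null set, and whose trace is the
   restriction to the boundary. *)
definition cem_form ::
    "plane set \<Rightarrow> (real \<Rightarrow> plane) \<Rightarrow> ('l::finite \<Rightarrow> plane set) \<Rightarrow> ('l \<Rightarrow> real) \<Rightarrow>
     (plane \<Rightarrow> real) \<Rightarrow> (plane \<Rightarrow> real) \<times> (real ^ 'l) \<Rightarrow> (plane \<Rightarrow> real) \<times> (real ^ 'l) \<Rightarrow> real" where
  "cem_form \<Omega> g E z \<sigma> = (\<lambda>(u, U) (v, V).
     (LINT x:\<Omega>|lebesgue. \<sigma> x * (gradient u x \<bullet> gradient v x)) +
     (\<Sum>l\<in>UNIV. 1 / z l * arclength_integral g (E l) (\<lambda>x. (u x - U $ l) * (v x - V $ l))))"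

definition cem_basis ::
    "('v \<Rightarrow> plane \<Rightarrow> real) \<Rightarrow> ('m \<Rightarrow> real ^ 'l) \<Rightarrow> 'v + 'm \<Rightarrow> (plane \<Rightarrow> real) \<times> (real ^ 'l)" where
  "cem_basis \<psi> \<E> i = (case i of Inl j \<Rightarrow> (\<psi> j, 0) | Inr m \<Rightarrow> (\<lambda>x. 0, \<E> m))"

definition stiffness_matrix ::
    "plane set \<Rightarrow> (real \<Rightarrow> plane) \<Rightarrow> ('l::finite \<Rightarrow> plane set) \<Rightarrow> ('l \<Rightarrow> real) \<Rightarrow>
     ('v::finite \<Rightarrow> plane \<Rightarrow> real) \<Rightarrow> ('m::finite \<Rightarrow> real ^ 'l) \<Rightarrow> (plane \<Rightarrow> real) \<Rightarrow>
     real ^ ('v + 'm) ^ ('v + 'm)" where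
  "stiffness_matrix \<Omega> g E z \<psi> \<E> \<sigma> =
     (\<chi> j k. cem_form \<Omega> g E z \<sigma> (cem_basis \<psi> \<E> j) (cem_basis \<psi> \<E> k))"

(* Here and below, d embeds the index type of the triangles that make up D into the index type
   of all triangles. *)
definition conductivity ::
    "('t \<Rightarrow> plane set) \<Rightarrow> ('n::finite \<Rightarrow> 't) \<Rightarrow> real \<Rightarrow> real ^ 'n \<Rightarrow> plane \<Rightarrow> real" where
  "conductivity K d \<sigma>0 \<xi> x = \<sigma>0 + (\<Sum>\<nu>\<in>UNIV. \<xi> $ \<nu> * indicator (K (d \<nu>)) x)"

(* The block column matrix [O; I]. *)
definition current_block :: "real ^ 'm ^ ('v::finite + 'm::finite)" where
  "current_block = (\<chi> i m. case i of Inl j \<Rightarrow> 0 | Inr m' \<Rightarrow> if m' = m then 1 else 0)"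

definition alpha ::
    "real ^ ('v::finite + 'm::finite) ^ ('v + 'm) \<Rightarrow> real ^ 'm ^ 'm" where
  "alpha A = transpose (current_block :: real ^ 'm ^ ('v + 'm)) ** matrix_inv A ** current_block"

(* Column stacking: the component (m, l) of the result is the entry in row l of column m. *)
definition vec_columns :: "real ^ 'm ^ 'l \<Rightarrow> real ^ ('m::finite \<times> 'l::finite)" where
  "vec_columns A = (\<chi> i. A $ snd i $ fst i)"

definition forward_map ::
    "plane set \<Rightarrow> (real \<Rightarrow> plane) \<Rightarrow> ('l::finite \<Rightarrow> plane set) \<Rightarrow> ('l \<Rightarrow> real) \<Rightarrow>
     ('v::finite \<Rightarrow> plane \<Rightarrow> real) \<Rightarrow> ('m::finite \<Rightarrow> real ^ 'l) \<Rightarrow>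
     ('t \<Rightarrow> plane set) \<Rightarrow> ('n::finite \<Rightarrow> 't) \<Rightarrow> real \<Rightarrow> real ^ 'n \<Rightarrow> real ^ ('m \<times> 'l)" where
  "forward_map \<Omega> g E z \<psi> \<E> K d \<sigma>0 \<xi> =
     vec_columns ((\<chi> l m. \<E> m $ l) **
       alpha (stiffness_matrix \<Omega> g E z \<psi> \<E> (conductivity K d \<sigma>0 \<xi>)))"

definition inclusion_region :: "('t \<Rightarrow> plane set) \<Rightarrow> ('n \<Rightarrow> 't) \<Rightarrow> plane set" where
  "inclusion_region K d = (\<Union>\<nu>. closure (K (d \<nu>)))"

(* e lists each mesh edge shared by two triangles, at least one of them in D, exactly once, as
   the ordered pair of these two triangles. The order, i.e. the orientation, is arbitrary. *)
definition oriented_edges ::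
    "('t \<Rightarrow> plane set) \<Rightarrow> ('n \<Rightarrow> 't) \<Rightarrow> ('e \<Rightarrow> 't \<times> 't) \<Rightarrow> bool" where
  "oriented_edges K d e \<longleftrightarrow>
     bij_betw (\<lambda>j. {fst (e j), snd (e j)}) UNIV
       {{\<nu>, \<mu>} | \<nu> \<mu>. 1 simplex (closure (K \<nu>) \<inter> closure (K \<mu>)) \<and>
          (K \<nu> \<subseteq> inclusion_region K d \<or> K \<mu> \<subseteq> inclusion_region K d)}"

definition increment_matrix ::
    "('n::finite \<Rightarrow> 't) \<Rightarrow> ('e::finite \<Rightarrow> 't \<times> 't) \<Rightarrow> real ^ 'n ^ 'e" where
  "increment_matrix d e =
     (\<chi> j \<nu>. if d \<nu> = fst (e j) then 1 else if d \<nu> = snd (e j) then -1 else 0)"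

(* The pseudoinverse of a matrix with linearly independent columns. *)
definition pinv_full_rank :: "real ^ 'n::finite ^ 'e::finite \<Rightarrow> real ^ 'e ^ 'n" where
  "pinv_full_rank A = matrix_inv (transpose A ** A) ** transpose A"

(* th0 holds the scale parameters of the gamma hyperprior. *)
definition gibbs_energy ::
    "real \<Rightarrow> real ^ 'k::finite \<Rightarrow> (real ^ 'n::finite \<Rightarrow> real ^ 'k) \<Rightarrow> real ^ 'e::finite ^ 'n \<Rightarrow>
     real \<Rightarrow> real ^ 'e \<Rightarrow> (real ^ 'e) \<times> (real ^ 'e) \<Rightarrow> real" where
  "gibbs_energy \<omega> b F Ld \<eta> th0 = (\<lambda>(\<zeta>, \<theta>).
     1 / (2 * \<omega>\<^sup>2) * (norm (b - F (Ld *v \<zeta>)))\<^sup>2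
     + 1 / 2 * (\<Sum>j\<in>UNIV. (\<zeta> $ j)\<^sup>2 / \<theta> $ j)
     + (\<Sum>j\<in>UNIV. \<theta> $ j / th0 $ j)
     - \<eta> * (\<Sum>j\<in>UNIV. ln (\<theta> $ j / th0 $ j)))"

end

theory Submission
  imports Defs
begin

text \<open>
  The stiffness matrix is an affine, increasing function of the conductivity values and it is
  positive definite when these are positive. The compressed inverse \<open>alpha\<close> is therefore decreasing
  and convex in the conductivity, both in the sense of the semidefinite ordering: its quadratic form
  is a supremum of functions \<open>2 (x \<bullet> y) - x \<bullet> A x\<close>, which are affine and decreasing in the matrix
  \<open>A\<close> (lemmas \<open>alpha_antimono\<close> and \<open>alpha_convex\<close>).

  Below the true conductivity, the difference of \<open>alpha\<close> and its true value is thus a positive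
  semidefinite, matrix-convex function of \<open>\<xi>\<close>. The Frobenius norm is increasing on positive
  semidefinite matrices, because the Frobenius inner product of two such matrices is nonnegative
  (\<open>psd_inner_nonneg\<close>). So the squared norm of the difference is convex
  (\<open>convex_on_norm_sq_psd\<close>). Since the columns of the voltage basis are orthonormal, this squared norm
  is the data misfit for noiseless data, and it remains convex after the linear substitution
  \<open>\<xi> = Ld *v \<zeta>\<close>.

  The remaining terms of the Gibbs energy are convex on their own: \<open>\<zeta>\<^sub>j\<^sup>2 / \<theta>\<^sub>j\<close> is the perspective of
  the square, the next term is linear, and the logarithm is concave and enters with the factor
  \<open>- \<eta> < 0\<close>.

  The analytic part is the positive definiteness of the stiffness matrix
  (\<open>pos_def_cell_stiffness\<close>). It requires the integrals over \<open>\<Omega>\<close> and over the electrodes to be genuine: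
  gradients are constant on the cells, which exhaust \<open>\<Omega>\<close> up to a null set, and the polygonal boundary
  curve has a piecewise constant, positive speed. Connectedness of \<open>\<Omega>\<close> then forces a potential of
  zero energy to be constant, and the electrodes force this constant to be zero.
\<close>

section \<open>Positive semidefinite matrices\<close>

definition psd :: "real ^ 'm::finite ^ 'm \<Rightarrow> bool" where
  "psd M \<longleftrightarrow> transpose M = M \<and> (\<forall>x. 0 \<le> x \<bullet> (M *v x))"

definition pos_def :: "real ^ 'm::finite ^ 'm \<Rightarrow> bool" where
  "pos_def M \<longleftrightarrow> transpose M = M \<and> (\<forall>x. x \<noteq> 0 \<longrightarrow> 0 < x \<bullet> (M *v x))"

lemma pos_def_imp_psd: "pos_def M \<Longrightarrow> psd M"
  unfolding pos_def_def psd_def by (metis inner_zero_left less_eq_real_def)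

lemma symmetric_form_commute:
  fixes M :: "real ^ 'm::finite ^ 'm"
  assumes "transpose M = M"
  shows "x \<bullet> (M *v y) = y \<bullet> (M *v x)"
  by (metis assms dot_lmul_matrix inner_commute transpose_matrix_vector)

lemma psd_cauchy_schwarz:
  assumes "psd M"
  shows "(x \<bullet> (M *v y))\<^sup>2 \<le> (x \<bullet> (M *v x)) * (y \<bullet> (M *v y))"
proof -
  let ?a = "x \<bullet> (M *v x)" and ?b = "x \<bullet> (M *v y)" and ?c = "y \<bullet> (M *v y)"
  have quad: "0 \<le> ?a + 2 * t * ?b + t\<^sup>2 * ?c" for t
  proof -
    have "0 \<le> (x + t *\<^sub>R y) \<bullet> (M *v (x + t *\<^sub>R y))"
      using assms psd_def by blast
    moreover have "y \<bullet> (M *v x) = ?b"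
      using assms symmetric_form_commute psd_def by blast
    ultimately show ?thesis
      by (simp add: algebra_simps inner_add_left inner_add_right matrix_vector_right_distrib
          matrix_vector_mult_scaleR power2_eq_square)
  qed
  show ?thesis
  proof (cases "?c = 0")
    case True
    have "?b = 0"
    proof (rule ccontr)
      assume "?b \<noteq> 0"
      with quad[of "- (?a + 1) / (2 * ?b)"] True show False
        by (simp add: field_simps)
    qed
    then show ?thesis using True by simp
  next
    case False
    then have "?c > 0"
      using assms psd_def by (metis less_eq_real_def)
    then show ?thesis
      using quad[of "- ?b / ?c"] by (simp add: field_simps power2_eq_square)
  qed
qed

lemma form_axis: "axis i 1 \<bullet> (M *v axis j 1) = (M :: real ^ 'm::finite ^ 'm) $ i $ j"
  by (simp add: inner_axis' matrix_vector_mult_basis column_def)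

definition outer_product :: "real ^ 'm::finite \<Rightarrow> real ^ 'm ^ 'm" where
  "outer_product p = (\<chi> i j. p $ i * p $ j)"

lemma inner_outer_product: "outer_product p \<bullet> R = p \<bullet> (R *v p)"
  by (simp add: outer_product_def inner_vec_def matrix_vector_mult_def sum_distrib_left mult_ac)

lemma form_outer_product: "x \<bullet> (outer_product p *v x) = (x \<bullet> p)\<^sup>2"
  by (simp add: outer_product_def inner_vec_def matrix_vector_mult_def sum_distrib_left mult_ac
      power2_eq_square sum_product)

text \<open>Gaussian elimination splits off from \<open>P\<close> a rank-one term \<open>p p\<^sup>T\<close>, whose inner product with \<open>R\<close> is the form
  value \<open>p \<bullet> R p\<close>; by the Cauchy-Schwarz inequality the remainder is again positive semidefinite,
  and it has fewer nonzero diagonal entries. When no nonzero diagonal entry is left, the same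
  inequality shows that the remainder is zero.\<close>

lemma psd_inner_nonneg:
  fixes P R :: "real ^ 'm::finite ^ 'm"
  assumes "psd P" "psd R"
  shows "0 \<le> P \<bullet> R"
  using assms(1)
proof (induction "card {i. P $ i $ i \<noteq> 0}" arbitrary: P rule: less_induct)
  case less
  have sym: "transpose P = P"
    using less.prems psd_def by blast
  have diag: "0 \<le> Q $ i $ i" if "psd Q" for Q :: "real ^ 'm ^ 'm" and i
    using that by (metis form_axis psd_def)
  show ?case
  proof (cases "\<forall>i. P $ i $ i = 0")
    case True
    have "P $ i $ j = 0" for i j
      using psd_cauchy_schwarz[OF less.prems, of "axis i 1" "axis j 1"] True
      by (simp add: form_axis)
    then have "P = 0"
      by (simp add: vec_eq_iff)
    then show ?thesis by simp
  next
    case False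
    then obtain i where i: "P $ i $ i > 0"
      using diag[OF less.prems] by (metis less_eq_real_def)
    define p where "p = P *v axis i 1"
    define P' where "P' = P - (1 / P $ i $ i) *\<^sub>R outer_product p"
    have p: "p $ j = P $ j $ i" for j
      by (simp add: p_def matrix_vector_mult_basis column_def)
    have entry: "P' $ j $ k = P $ j $ k - P $ j $ i * P $ k $ i / P $ i $ i" for j k
      by (simp add: P'_def outer_product_def p)
    have "x \<bullet> (P' *v x) = x \<bullet> (P *v x) - (x \<bullet> p)\<^sup>2 / P $ i $ i" for x
      by (simp add: P'_def matrix_vector_mult_diff_rdistrib inner_diff_right
          scaleR_matrix_vector_assoc[symmetric] form_outer_product)
    moreover have "(x \<bullet> p)\<^sup>2 \<le> (x \<bullet> (P *v x)) * P $ i $ i" for x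
      using psd_cauchy_schwarz[OF less.prems, of x "axis i 1"] by (simp add: p_def form_axis)
    ultimately have "0 \<le> x \<bullet> (P' *v x)" for x
      using i by (metis diff_ge_0_iff_ge pos_divide_le_eq)
    moreover have "transpose P' = P'"
      using sym by (simp add: vec_eq_iff transpose_def entry mult.commute)
    ultimately have psd': "psd P'"
      by (simp add: psd_def)
    have "P' $ k $ k = 0" if "P $ k $ k = 0" for k
    proof (rule antisym)
      show "P' $ k $ k \<le> 0"
        using i that by (simp add: entry)
    qed (rule diag[OF psd'])
    then have "{k. P' $ k $ k \<noteq> 0} \<subseteq> {k. P $ k $ k \<noteq> 0} - {i}"
      using i by (auto simp: entry)
    then have "{k. P' $ k $ k \<noteq> 0} \<subset> {k. P $ k $ k \<noteq> 0}"
      using i by auto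
    then have "0 \<le> P' \<bullet> R"
      by (intro less.hyps psd' psubset_card_mono) auto
    moreover have "P \<bullet> R = P' \<bullet> R + (1 / P $ i $ i) * (p \<bullet> (R *v p))"
      by (simp add: P'_def inner_diff_left inner_outer_product)
    moreover have "0 \<le> p \<bullet> (R *v p)"
      using assms(2) psd_def by blast
    ultimately show ?thesis
      using i by simp
  qed
qed

text \<open>In the expansion of the squared norm of \<open>P + (Q - P)\<close> the cross term is nonnegative.\<close>

lemma psd_norm_mono:
  fixes P Q :: "real ^ 'm::finite ^ 'm"
  assumes "psd P" "psd (Q - P)"
  shows "norm P \<le> norm Q"
proof -
  have "Q \<bullet> Q = P \<bullet> P + 2 * (P \<bullet> (Q - P)) + (Q - P) \<bullet> (Q - P)"
    by (simp add: inner_diff_left inner_diff_right inner_commute)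
  moreover have "0 \<le> P \<bullet> (Q - P)"
    by (rule psd_inner_nonneg[OF assms])
  ultimately have "P \<bullet> P \<le> Q \<bullet> Q"
    using inner_ge_zero[of "Q - P"] by linarith
  then show ?thesis
    by (simp add: norm_le)
qed

text \<open>Semidefiniteness and matrix convexity put \<open>M\<close> at a convex combination between zero and the
  convex combination of the values, so that monotonicity of the norm applies. The rest is convexity
  of the norm and of the square.\<close>

lemma convex_on_norm_sq_psd:
  fixes M :: "'a::real_vector \<Rightarrow> real ^ 'm::finite ^ 'm"
  assumes "convex S" and psd: "\<And>x. x \<in> S \<Longrightarrow> psd (M x)"
    and conv: "\<And>x y u v. \<lbrakk>x \<in> S; y \<in> S; 0 \<le> u; 0 \<le> v; u + v = 1\<rbrakk>
      \<Longrightarrow> psd (u *\<^sub>R M x + v *\<^sub>R M y - M (u *\<^sub>R x + v *\<^sub>R y))"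
  shows "convex_on S (\<lambda>x. (norm (M x))\<^sup>2)"
  unfolding convex_on_def
proof (intro conjI ballI allI impI assms(1))
  fix x y and u v :: real
  assume xy: "x \<in> S" "y \<in> S" and uv: "0 \<le> u" "0 \<le> v" "u + v = 1"
  have "norm (M (u *\<^sub>R x + v *\<^sub>R y)) \<le> norm (u *\<^sub>R M x + v *\<^sub>R M y)"
    using xy uv assms(1) by (intro psd_norm_mono psd conv) (auto simp: convex_def)
  also have "\<dots> \<le> u * norm (M x) + v * norm (M y)"
    using uv by (metis abs_of_nonneg norm_scaleR norm_triangle_ineq)
  finally have "(norm (M (u *\<^sub>R x + v *\<^sub>R y)))\<^sup>2 \<le> (u * norm (M x) + v * norm (M y))\<^sup>2"
    by (simp add: power_mono)
  also have "\<dots> = u * (norm (M x))\<^sup>2 + v * (norm (M y))\<^sup>2 - u * v * (norm (M x) - norm (M y))\<^sup>2"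
  proof -
    have v: "v = 1 - u" using uv by simp
    show ?thesis unfolding v by (simp add: power2_eq_square algebra_simps)
  qed
  also have "\<dots> \<le> u * (norm (M x))\<^sup>2 + v * (norm (M y))\<^sup>2"
    using uv by simp
  finally show "(norm (M (u *\<^sub>R x + v *\<^sub>R y)))\<^sup>2 \<le> u * (norm (M x))\<^sup>2 + v * (norm (M y))\<^sup>2" .
qed

section \<open>The compressed inverse is decreasing and convex\<close>

lemma pos_def_inverse:
  assumes "pos_def A"
  shows "A ** matrix_inv A = mat 1" "matrix_inv A ** A = mat 1"
    "transpose (matrix_inv A) = matrix_inv A"
proof -
  have "inj ((*v) A)"
  proof (rule injI)
    fix x y assume "A *v x = A *v y"
    then have "(x - y) \<bullet> (A *v (x - y)) = 0"
      by (simp add: matrix_vector_mult_diff_distrib)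
    then show "x = y"
      using assms unfolding pos_def_def by (metis less_irrefl right_minus_eq)
  qed
  then have "invertible A"
    by (meson invertible_left_inverse matrix_left_invertible_injective)
  then show inv: "A ** matrix_inv A = mat 1" "matrix_inv A ** A = mat 1"
    by (auto simp: invertible_def matrix_inv_def intro: someI2_ex)
  have "transpose A = A"
    using assms pos_def_def by blast
  then have "transpose (matrix_inv A) ** A = mat 1"
    using inv(1) by (metis matrix_transpose_mul transpose_mat)
  then show "transpose (matrix_inv A) = matrix_inv A"
    using inv(1) by (metis matrix_mul_assoc matrix_mul_lid matrix_mul_rid)
qed

text \<open>The next two lemmas give \<open>y \<bullet> A\<^sup>-\<^sup>1 y\<close> as the maximum over \<open>x\<close> of
  \<open>2 (x \<bullet> y) - x \<bullet> A x\<close>, attained at \<open>x = A\<^sup>-\<^sup>1 y\<close>. For fixed \<open>x\<close> this expression is affine in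
  \<open>A\<close> and decreasing in \<open>A\<close>; hence the maximum is convex and decreasing in \<open>A\<close>.\<close>

lemma inverse_form_attained:
  assumes "pos_def A"
  shows "y \<bullet> (matrix_inv A *v y) =
    2 * ((matrix_inv A *v y) \<bullet> y) - (matrix_inv A *v y) \<bullet> (A *v (matrix_inv A *v y))"
  by (simp add: matrix_vector_mul_assoc pos_def_inverse(1)[OF assms] inner_commute)

text \<open>The difference of the two sides is the form of \<open>A\<close> at \<open>x - A\<^sup>-\<^sup>1 y\<close>.\<close>

lemma inverse_form_upper:
  assumes "pos_def A"
  shows "2 * (x \<bullet> y) - x \<bullet> (A *v x) \<le> y \<bullet> (matrix_inv A *v y)"
proof -
  let ?w = "matrix_inv A *v y"
  have "0 \<le> (x - ?w) \<bullet> (A *v (x - ?w))"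
    using assms pos_def_imp_psd psd_def by blast
  also have "\<dots> = x \<bullet> (A *v x) - 2 * (x \<bullet> (A *v ?w)) + ?w \<bullet> (A *v ?w)"
    using symmetric_form_commute[of A x ?w] assms
    by (simp add: pos_def_def matrix_vector_mult_diff_distrib inner_diff_left inner_diff_right)
  also have "\<dots> = x \<bullet> (A *v x) - 2 * (x \<bullet> y) + y \<bullet> ?w"
    by (simp add: matrix_vector_mul_assoc pos_def_inverse(1)[OF assms] inner_commute)
  finally show ?thesis by simp
qed

lemma alpha_form:
  fixes A :: "real ^ ('v::finite + 'm::finite) ^ ('v + 'm)"
  shows "w \<bullet> (alpha A *v w) = (current_block *v w) \<bullet> (matrix_inv A *v (current_block *v w))"
  unfolding alpha_def
  by (metis dot_lmul_matrix matrix_vector_mul_assoc vector_transpose_matrix)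

lemma transpose_alpha: "pos_def A \<Longrightarrow> transpose (alpha A) = alpha A"
  by (simp add: alpha_def matrix_transpose_mul pos_def_inverse(3) matrix_mul_assoc)

lemma transpose_diff: "transpose (A - B) = transpose A - transpose (B :: real ^ 'a ^ 'b)"
  by (simp add: transpose_def vec_eq_iff)

lemma transpose_add: "transpose (A + B) = transpose A + transpose (B :: real ^ 'a ^ 'b)"
  by (simp add: transpose_def vec_eq_iff)

text \<open>At the maximizer \<open>x\<close> for the larger matrix \<open>B\<close>, the expression for \<open>A\<close> is at least as large.\<close>

lemma alpha_antimono:
  fixes A B :: "real ^ ('v::finite + 'm::finite) ^ ('v + 'm)"
  assumes "pos_def A" "pos_def B" and le: "\<And>x. x \<bullet> (A *v x) \<le> x \<bullet> (B *v x)"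
  shows "psd (alpha A - alpha B)"
  unfolding psd_def
proof (intro conjI allI)
  show "transpose (alpha A - alpha B) = alpha A - alpha B"
    by (simp add: transpose_diff transpose_alpha assms)
  fix w
  let ?y = "current_block *v w :: real ^ ('v + 'm)"
  let ?x = "matrix_inv B *v ?y"
  have "w \<bullet> (alpha B *v w) = 2 * (?x \<bullet> ?y) - ?x \<bullet> (B *v ?x)"
    by (simp only: alpha_form inverse_form_attained[OF assms(2)])
  also have "\<dots> \<le> 2 * (?x \<bullet> ?y) - ?x \<bullet> (A *v ?x)"
    using le by simp
  also have "\<dots> \<le> w \<bullet> (alpha A *v w)"
    unfolding alpha_form by (rule inverse_form_upper[OF assms(1)])
  finally show "0 \<le> w \<bullet> ((alpha A - alpha B) *v w)"
    by (simp add: matrix_vector_mult_diff_rdistrib inner_diff_right)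
qed

text \<open>At the maximizer for the convex combination, the affine expression splits, and each part is
  bounded by its own maximum.\<close>

lemma alpha_convex:
  fixes A B :: "real ^ ('v::finite + 'm::finite) ^ ('v + 'm)"
  assumes "pos_def A" "pos_def B" "pos_def (u *\<^sub>R A + v *\<^sub>R B)" "0 \<le> u" "0 \<le> v" "u + v = 1"
  shows "psd (u *\<^sub>R alpha A + v *\<^sub>R alpha B - alpha (u *\<^sub>R A + v *\<^sub>R B))"
  unfolding psd_def
proof (intro conjI allI)
  let ?D = "u *\<^sub>R A + v *\<^sub>R B"
  let ?M = "u *\<^sub>R alpha A + v *\<^sub>R alpha B - alpha ?D"
  show "transpose ?M = ?M"
    by (simp add: transpose_diff transpose_add transpose_scalar transpose_alpha assms)
  fix w
  let ?y = "current_block *v w :: real ^ ('v + 'm)"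
  let ?x = "matrix_inv ?D *v ?y"
  have "w \<bullet> (alpha ?D *v w) = 2 * (?x \<bullet> ?y) - ?x \<bullet> (?D *v ?x)"
    by (simp only: alpha_form inverse_form_attained[OF assms(3)])
  also have "\<dots> = 2 * (u + v) * (?x \<bullet> ?y) - ?x \<bullet> (?D *v ?x)"
    using assms(6) by simp
  also have "\<dots> = u * (2 * (?x \<bullet> ?y) - ?x \<bullet> (A *v ?x)) + v * (2 * (?x \<bullet> ?y) - ?x \<bullet> (B *v ?x))"
    by (simp add: matrix_vector_mult_add_rdistrib inner_add_right algebra_simps
        scaleR_matrix_vector_assoc[symmetric])
  also have "\<dots> \<le> u * (w \<bullet> (alpha A *v w)) + v * (w \<bullet> (alpha B *v w))"
    unfolding alpha_form using assms
    by (intro add_mono mult_left_mono inverse_form_upper)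
  finally show "0 \<le> w \<bullet> (?M *v w)"
    by (simp add: matrix_vector_mult_diff_rdistrib matrix_vector_mult_add_rdistrib
        inner_add_right inner_diff_right scaleR_matrix_vector_assoc[symmetric])
qed

text \<open>The columns of \<open>\<E>\<close> are orthonormal, so multiplication from the left preserves the length of
  every column of \<open>D\<close>. Hence the voltage misfit can be measured on the \<open>alpha\<close> matrices.\<close>

lemma norm_vec_columns_isometry:
  fixes D :: "real ^ 'm::finite ^ 'm" and \<E> :: "'m \<Rightarrow> real ^ 'l::finite"
  assumes "orthonormal_basis_mean_free \<E>"
  shows "norm (vec_columns ((\<chi> l m. \<E> m $ l) ** D)) = norm D"
proof -
  have "(norm (vec_columns ((\<chi> l m. \<E> m $ l) ** D)))\<^sup>2
      = (\<Sum>m\<in>UNIV. \<Sum>l\<in>UNIV. (\<Sum>k\<in>UNIV. \<E> k $ l * D $ k $ m)\<^sup>2)"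
    unfolding power2_norm_eq_inner
    by (simp add: vec_columns_def inner_vec_def matrix_matrix_mult_def
        power2_eq_square sum.cartesian_product UNIV_Times_UNIV split_def)
  also have "\<dots> = (\<Sum>m\<in>UNIV. \<Sum>k\<in>UNIV. (D $ k $ m)\<^sup>2)"
  proof (rule sum.cong[OF refl])
    fix m
    have "(\<Sum>l\<in>UNIV. (\<Sum>k\<in>UNIV. \<E> k $ l * D $ k $ m)\<^sup>2)
        = (\<Sum>k\<in>UNIV. D $ k $ m *\<^sub>R \<E> k) \<bullet> (\<Sum>k\<in>UNIV. D $ k $ m *\<^sub>R \<E> k)"
      by (simp add: inner_vec_def[of "sum _ _"] power2_eq_square mult.commute)
    also have "\<dots> = (\<Sum>j\<in>UNIV. \<Sum>k\<in>UNIV. D $ j $ m * D $ k $ m * (\<E> k \<bullet> \<E> j))"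
      by (simp add: inner_sum_left inner_sum_right mult.assoc sum_distrib_left)
    also have "\<dots> = (\<Sum>j\<in>UNIV. \<Sum>k\<in>UNIV. if j = k then (D $ k $ m)\<^sup>2 else 0)"
      using assms
      by (intro sum.cong refl) (auto simp: orthonormal_basis_mean_free_def power2_eq_square)
    also have "\<dots> = (\<Sum>k\<in>UNIV. (D $ k $ m)\<^sup>2)"
      by simp
    finally show "(\<Sum>l\<in>UNIV. (\<Sum>k\<in>UNIV. \<E> k $ l * D $ k $ m)\<^sup>2)
      = (\<Sum>k\<in>UNIV. (D $ k $ m)\<^sup>2)" .
  qed
  also have "\<dots> = (\<Sum>k\<in>UNIV. \<Sum>m\<in>UNIV. (D $ k $ m)\<^sup>2)"
    by (rule sum.swap)
  also have "\<dots> = (norm D)\<^sup>2"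
    unfolding power2_norm_eq_inner by (simp add: inner_vec_def power2_eq_square)
  finally show ?thesis
    by simp
qed

section \<open>Convexity of the prior\<close>

text \<open>The scalar counterpart of the bound for the inverse form, with equality at \<open>s = x / \<theta>\<close>: it
  shows \<open>x\<^sup>2 / \<theta>\<close> as a supremum of functions linear in \<open>(x, \<theta>)\<close>, which makes it jointly convex.\<close>

lemma quotient_form_upper:
  fixes x s \<theta> :: real
  assumes "\<theta> > 0"
  shows "2 * s * x - s\<^sup>2 * \<theta> \<le> x\<^sup>2 / \<theta>"
proof -
  have "x\<^sup>2 / \<theta> - (2 * s * x - s\<^sup>2 * \<theta>) = (x - s * \<theta>)\<^sup>2 / \<theta>"
    using assms by (simp add: field_simps power2_eq_square)
  then show ?thesis
    using assms by (metis diff_ge_0_iff_ge divide_nonneg_pos zero_le_power2)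
qed

lemma square_over_linear_convex:
  fixes x y \<theta> \<tau> u v :: real
  assumes "\<theta> > 0" "\<tau> > 0" "0 \<le> u" "0 \<le> v" "u + v = 1"
  shows "(u * x + v * y)\<^sup>2 / (u * \<theta> + v * \<tau>) \<le> u * (x\<^sup>2 / \<theta>) + v * (y\<^sup>2 / \<tau>)"
proof -
  let ?s = "(u * x + v * y) / (u * \<theta> + v * \<tau>)"
  have pos: "u * \<theta> + v * \<tau> > 0"
    using assms by (metis add_0 add_nonneg_pos add_pos_nonneg less_eq_real_def mult_nonneg_nonneg
        mult_pos_pos zero_neq_one)
  have "(u * x + v * y)\<^sup>2 / (u * \<theta> + v * \<tau>)
      = 2 * ?s * (u * x + v * y) - ?s\<^sup>2 * (u * \<theta> + v * \<tau>)"
    using pos by (simp add: power2_eq_square)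
  also have "\<dots> = u * (2 * ?s * x - ?s\<^sup>2 * \<theta>) + v * (2 * ?s * y - ?s\<^sup>2 * \<tau>)"
    by (simp only: algebra_simps)
  also have "\<dots> \<le> u * (x\<^sup>2 / \<theta>) + v * (y\<^sup>2 / \<tau>)"
    using assms by (intro add_mono mult_left_mono quotient_form_upper)
  finally show ?thesis .
qed

lemma convex_on_compose_linear:
  assumes "linear f" "convex_on T h" "convex S" "f ` S \<subseteq> T"
  shows "convex_on S (\<lambda>x. h (f x))"
  using assms unfolding convex_on_def
  by (auto simp: linear_add linear_scale image_subset_iff)

lemma convex_on_finite_sum:
  assumes "finite I" "convex S" "\<And>i. i \<in> I \<Longrightarrow> convex_on S (f i)"
  shows "convex_on S (\<lambda>x. \<Sum>i\<in>I. f i x)"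
  using assms by (induction I rule: finite_induct) (auto simp: convex_on_const intro: convex_on_add)

lemma convex_on_square_quotient:
  fixes S :: "((real ^ 'e::finite) \<times> (real ^ 'e)) set"
  assumes "convex S" and "\<And>\<zeta> \<theta> j. (\<zeta>, \<theta>) \<in> S \<Longrightarrow> \<theta> $ j > 0"
  shows "convex_on S (\<lambda>(\<zeta>, \<theta>). (\<zeta> $ j)\<^sup>2 / \<theta> $ j)"
  unfolding convex_on_def
proof (intro conjI ballI allI impI assms(1))
  fix x y and u v :: real
  assume xy: "x \<in> S" "y \<in> S" and uv: "0 \<le> u" "0 \<le> v" "u + v = 1"
  obtain \<zeta> \<theta> \<zeta>' \<theta>' where eq: "x = (\<zeta>, \<theta>)" "y = (\<zeta>', \<theta>')"
    by (metis surj_pair)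
  then show "(case u *\<^sub>R x + v *\<^sub>R y of (\<zeta>, \<theta>) \<Rightarrow> (\<zeta> $ j)\<^sup>2 / \<theta> $ j)
    \<le> u * (case x of (\<zeta>, \<theta>) \<Rightarrow> (\<zeta> $ j)\<^sup>2 / \<theta> $ j)
      + v * (case y of (\<zeta>, \<theta>) \<Rightarrow> (\<zeta> $ j)\<^sup>2 / \<theta> $ j)"
    using square_over_linear_convex[of "\<theta> $ j" "\<theta>' $ j" u v "\<zeta> $ j" "\<zeta>' $ j"] assms(2) xy uv
    by simp
qed

lemma convex_on_eq_on:
  assumes "convex_on S f" "\<And>x. x \<in> S \<Longrightarrow> f x = h x"
  shows "convex_on S h"
  using assms unfolding convex_on_def by (metis convex_def)

lemma convex_on_minus_ln_scaled:
  assumes "c > 0"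
  shows "convex_on {0<..} (\<lambda>t :: real. - ln (t / c))"
proof -
  have "convex_on {0<..} (\<lambda>t :: real. - ln t + ln c)"
    using ln_concave
    by (intro convex_on_add) (auto simp: convex_on_const concave_on_def)
  then show ?thesis
    by (rule convex_on_eq_on) (use assms in \<open>auto simp: ln_divide_pos\<close>)
qed

section \<open>Arc length along a polygonal curve\<close>

text \<open>A polygonal path determines its derivative only inside its straight pieces; at the corners
  \<open>vector_derivative\<close> may take any value. So the derivative is recorded on the open interval.\<close>

definition affine_piece :: "(real \<Rightarrow> plane) \<Rightarrow> real \<Rightarrow> real \<Rightarrow> bool" where
  "affine_piece g a b \<longleftrightarrow> a < b \<and> (\<forall>x\<in>{a<..<b}. g x = g a + ((x - a) / (b - a)) *\<^sub>R (g b - g a)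
     \<and> vector_derivative g (at x) = (1 / (b - a)) *\<^sub>R (g b - g a))"

text \<open>A polygonal path is straight over every gap between corner times. A given time is assigned the
  gap from the largest corner time below it to the smallest one above it; 0 and 1 are counted among
  the corner times in order that these exist.\<close>

lemma polygonal_path_affine_pieces:
  assumes "polygonal_path g"
  obtains S where "finite S" "S \<subseteq> {0..1}" "0 \<in> S" "1 \<in> S"
    "\<And>t. t \<in> {0..1} - S \<Longrightarrow> \<exists>a\<in>S. \<exists>b\<in>S. a < t \<and> t < b \<and> affine_piece g a b"
proof -
  obtain S0 where S0: "finite S0"
    "\<And>a b t. \<lbrakk>0 \<le> a; a < b; b \<le> 1; {a<..<b} \<inter> S0 = {}; t \<in> {0..1}\<rbrakk>
       \<Longrightarrow> g (linepath a b t) = linepath (g a) (g b) t"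
    using assms unfolding polygonal_path_def by blast
  define S where "S = (S0 \<inter> {0..1}) \<union> {0, 1}"
  show thesis
  proof
    show fin: "finite S" and sub: "S \<subseteq> {0..1}" and mem: "0 \<in> S" "1 \<in> S"
      using S0(1) by (auto simp: S_def)
    fix t assume t: "t \<in> {0..1} - S"
    then have t01: "0 < t" "t < 1"
      using mem by (auto simp: less_eq_real_def)
    define a where "a = Max {s \<in> S. s < t}"
    define b where "b = Min {s \<in> S. t < s}"
    have "a \<in> {s \<in> S. s < t}" "b \<in> {s \<in> S. t < s}"
      unfolding a_def b_def by (intro Max_in Min_in; use fin mem t01 in auto)+
    then have ab: "a \<in> S" "a < t" "b \<in> S" "t < b"
      by auto
    have max: "s \<le> a" if "s \<in> S" "s < t" for s
      unfolding a_def by (rule Max_ge) (use fin that in auto)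
    have min: "b \<le> s" if "s \<in> S" "t < s" for s
      unfolding b_def by (rule Min_le) (use fin that in auto)
    have gap: "{a<..<b} \<inter> S = {}"
      using max min t by (auto; metis not_less_iff_gr_or_eq leD DiffE)
    have bounds: "0 \<le> a" "b \<le> 1"
      using ab sub by auto
    then have "{a<..<b} \<inter> S0 = {}"
      using gap by (auto simp: S_def)
    note lin = S0(2)[OF bounds(1) _ bounds(2) this]
    have affine: "g x = g a + ((x - a) / (b - a)) *\<^sub>R (g b - g a)" if x: "x \<in> {a<..<b}" for x
    proof -
      define r where "r = (x - a) / (b - a)"
      have "r * (b - a) = x - a"
        using x by (simp add: r_def)
      then have "x = linepath a b r"
        by (simp add: linepath_def algebra_simps)
      moreover have "r \<in> {0..1}"
        using x by (simp add: r_def)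
      ultimately have "g x = linepath (g a) (g b) r"
        using lin[of r] ab by simp
      then show ?thesis
        by (simp add: r_def[symmetric] linepath_def algebra_simps)
    qed
    have "vector_derivative g (at x) = (1 / (b - a)) *\<^sub>R (g b - g a)" if x: "x \<in> {a<..<b}" for x
    proof (rule vector_derivative_at)
      have "((\<lambda>x. g a + ((x - a) / (b - a)) *\<^sub>R (g b - g a))
          has_vector_derivative (1 / (b - a)) *\<^sub>R (g b - g a)) (at x)"
        using ab by (auto intro!: derivative_eq_intros simp: divide_simps)
      then show "(g has_vector_derivative (1 / (b - a)) *\<^sub>R (g b - g a)) (at x)"
        by (rule has_vector_derivative_transform_within_open[of _ _ _ "{a<..<b}"])
          (use x affine in auto)
    qed
    with affine ab have "affine_piece g a b"
      unfolding affine_piece_def by auto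
    with ab show "\<exists>a\<in>S. \<exists>b\<in>S. a < t \<and> t < b \<and> affine_piece g a b"
      by blast
  qed
qed

lemma polygonal_speed_pos:
  assumes "polygonal_path g" "simple_path g"
  obtains S where "finite S" "\<And>t. t \<in> {0..1} - S \<Longrightarrow> 0 < norm (vector_derivative g (at t))"
proof -
  obtain S where S: "finite S" "S \<subseteq> {0..1}"
    "\<And>t. t \<in> {0..1} - S \<Longrightarrow> \<exists>a\<in>S. \<exists>b\<in>S. a < t \<and> t < b \<and> affine_piece g a b"
    using polygonal_path_affine_pieces[OF assms(1)] by metis
  show thesis
  proof
    show "finite S" by fact
    fix t assume "t \<in> {0..1} - S"
    then obtain a b where ab: "a \<in> S" "b \<in> S" "a < t" "t < b" "affine_piece g a b"
      using S(3) by metis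
    then have piece: "\<And>x. x \<in> {a<..<b} \<Longrightarrow> g x = g a + ((x - a) / (b - a)) *\<^sub>R (g b - g a)
        \<and> vector_derivative g (at x) = (1 / (b - a)) *\<^sub>R (g b - g a)"
      unfolding affine_piece_def by blast
    \<comment> \<open>If the end values agreed, the curve would stand still between \<open>t\<close> and \<open>t'\<close>.\<close>
    define t' where "t' = (t + b) / 2"
    have t': "t' \<in> {a<..<b}" "t < t'"
      using ab by (auto simp: t'_def)
    have "0 \<le> a" "b \<le> 1"
      using ab S(2) by auto
    then have "g t \<noteq> g t'"
      using assms(2) ab t' unfolding simple_path_def loop_free_def by force
    then have "g b \<noteq> g a"
      using ab(3,4) piece[of t] piece[OF t'(1)] by auto
    then show "0 < norm (vector_derivative g (at t))"
      using ab piece[of t] by simp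
  qed
qed

text \<open>The speed of a polygonal curve is locally constant away from the finitely many corner times,
  which makes it measurable, and it takes only finitely many values there, which makes it bounded.\<close>

lemma arclength_integrable:
  fixes f :: "plane \<Rightarrow> real"
  assumes "polygonal_path g" "continuous_on (path_image g) f"
  shows "set_integrable lebesgue {0..1} (\<lambda>t. f (g t) * norm (vector_derivative g (at t)))"
proof -
  obtain S where S: "finite S" "S \<subseteq> {0..1}" "0 \<in> S" "1 \<in> S"
    "\<And>t. t \<in> {0..1} - S \<Longrightarrow> \<exists>a\<in>S. \<exists>b\<in>S. a < t \<and> t < b \<and> affine_piece g a b"
    using polygonal_path_affine_pieces[OF assms(1)] by metis
  define W where "W = {0..1} - S"
  define h where "h = (\<lambda>t. norm (vector_derivative g (at t)))"
  have "W = {0<..<1} - S"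
    using S(3,4) by (auto simp: W_def less_eq_real_def)
  then have "open W"
    using S(1) by (simp add: open_Diff finite_imp_closed)
  then have W: "W \<in> sets lebesgue"
    by (simp add: borel_open)
  have path: "continuous_on {0..1} g"
    using assms(1) unfolding polygonal_path_def path_def by blast
  have fg: "continuous_on {0..1} (\<lambda>t. f (g t))"
    by (rule continuous_on_compose2[OF assms(2) path]) (auto simp: path_image_def)
  have "isCont h t" if t: "t \<in> W" for t
  proof -
    obtain a b where "a < t" "t < b" "affine_piece g a b"
      using S(5)[of t] t unfolding W_def by metis
    then have ab: "a < t" "t < b"
      "\<And>x. x \<in> {a<..<b} \<Longrightarrow> vector_derivative g (at x) = (1 / (b - a)) *\<^sub>R (g b - g a)"
      unfolding affine_piece_def by auto
    have "((\<lambda>_. norm ((1 / (b - a)) *\<^sub>R (g b - g a))) has_derivative (\<lambda>_. 0)) (at t)"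
      by simp
    then have "(h has_derivative (\<lambda>_. 0)) (at t)"
      by (rule has_derivative_transform_within_open[of _ _ _ _ "{a<..<b}"])
        (use ab in \<open>auto simp: h_def\<close>)
    then show ?thesis
      by (rule has_derivative_continuous)
  qed
  then have "continuous_on W h"
    by (simp add: continuous_at_imp_continuous_on)
  moreover have "continuous_on W (\<lambda>t. f (g t))"
    using fg by (rule continuous_on_subset) (auto simp: W_def)
  ultimately have meas: "(\<lambda>t. f (g t) * h t) \<in> borel_measurable (lebesgue_on W)"
    using W by (intro continuous_imp_measurable_on_sets_lebesgue continuous_on_mult)
  have "h ` W \<subseteq> (\<lambda>(a, b). norm ((1 / (b - a)) *\<^sub>R (g b - g a))) ` (S \<times> S)"
  proof
    fix y assume "y \<in> h ` W"
    then obtain t where t: "t \<in> W" "y = h t"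
      by blast
    then obtain a b where ab: "a \<in> S" "b \<in> S" "a < t" "t < b" "affine_piece g a b"
      using S(5)[of t] unfolding W_def by metis
    then have "vector_derivative g (at t) = (1 / (b - a)) *\<^sub>R (g b - g a)"
      unfolding affine_piece_def by auto
    then show "y \<in> (\<lambda>(a, b). norm ((1 / (b - a)) *\<^sub>R (g b - g a))) ` (S \<times> S)"
      using t(2) ab unfolding h_def by force
  qed
  then have "finite (h ` W)"
    using S(1) finite_subset by blast
  then obtain B1 where B1: "\<And>t. t \<in> W \<Longrightarrow> \<bar>h t\<bar> \<le> B1"
    using finite_imp_bounded bounded_real by (metis imageI)
  have "bounded ((\<lambda>t. f (g t)) ` {0..1})"
    using fg by (intro compact_imp_bounded compact_continuous_image) auto
  then obtain B2 where B2: "\<And>t. t \<in> {0..1} \<Longrightarrow> \<bar>f (g t)\<bar> \<le> B2"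
    using bounded_real by (metis imageI)
  have "(\<lambda>t. f (g t) * h t) absolutely_integrable_on W"
  proof (rule measurable_bounded_by_integrable_imp_absolutely_integrable[OF meas W])
    have "W \<in> lmeasurable"
      using W by (intro bounded_set_imp_lmeasurable) (auto simp: W_def intro: bounded_subset[of "{0..1}"])
    then show "(\<lambda>_. B2 * B1) integrable_on W"
      by (simp add: integrable_on_const)
    show "norm (f (g t) * h t) \<le> B2 * B1" if "t \<in> W" for t
      using mult_mono[of "\<bar>f (g t)\<bar>" B2 "\<bar>h t\<bar>" B1] B1[OF that] B2[of t] that
      by (simp add: W_def abs_mult)
  qed
  then have "(\<lambda>t. f (g t) * h t) absolutely_integrable_on {0..1}"
    by (rule absolutely_integrable_spike_set)
      (auto simp: W_def intro: negligible_subset[OF negligible_finite[OF S(1)]])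
  then show ?thesis
    by (simp add: h_def)
qed

text \<open>Moving the base point translates the parameter by \<open>s\<close> modulo 1, and a simple closed curve
  takes no value twice except at the times 0 and 1. This description of the times spent in an
  electrode gives both their measurability and an open set among them.\<close>

lemma curve_interval_times:
  assumes "simple_path g" "s \<in> {0..1}" "J \<subseteq> {0..1}"
  shows "{t \<in> {0..1}. g t \<in> shiftpath s g ` J} \<inter> {0<..<1} =
    ((+) s ` J \<union> (+) (s - 1) ` J) \<inter> {0<..<1}"
proof (intro equalityI subsetI)
  fix t assume t: "t \<in> {t \<in> {0..1}. g t \<in> shiftpath s g ` J} \<inter> {0<..<1}"
  then obtain j where j: "j \<in> J" "g t = shiftpath s g j"
    by blast
  define r where "r = (if s + j \<le> 1 then s + j else s + j - 1)"
  have "r \<in> {0..1}" "g t = g r"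
    using j assms(2,3) by (auto simp: r_def shiftpath_def)
  then have "t = r"
    using assms(1) t unfolding simple_path_def loop_free_def by force
  then show "t \<in> ((+) s ` J \<union> (+) (s - 1) ` J) \<inter> {0<..<1}"
    using t j(1) by (auto simp: r_def image_iff split: if_splits)
next
  fix t assume t: "t \<in> ((+) s ` J \<union> (+) (s - 1) ` J) \<inter> {0<..<1}"
  then obtain j where "j \<in> J" "t = s + j \<or> t = s - 1 + j"
    by blast
  then have "g t = shiftpath s g j"
    using t by (auto simp: shiftpath_def algebra_simps)
  with \<open>j \<in> J\<close> t show "t \<in> {t \<in> {0..1}. g t \<in> shiftpath s g ` J} \<inter> {0<..<1}"
    by auto
qed

lemma curve_interval_times_measurable:
  assumes "simple_path g" "curve_interval g A"
  shows "{t \<in> {0..1}. g t \<in> A} \<in> sets lebesgue"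
proof -
  obtain s J where sJ: "s \<in> {0..1}" "J \<subseteq> {0..1}" "is_interval J" "A = shiftpath s g ` J"
    using assms(2) unfolding curve_interval_def by blast
  let ?T = "{t \<in> {0..1}. g t \<in> A}"
  have "convex J" "bounded J"
    using sJ by (auto simp: is_interval_convex_1 intro: bounded_subset[of "{0..1}"])
  then have "(+) c ` J \<in> sets lebesgue" for c
    by (intro fmeasurableD measurable_convex convex_translation bounded_translation)
  then have "?T \<inter> {0<..<1} \<in> sets lebesgue"
    unfolding sJ(4) curve_interval_times[OF assms(1) sJ(1,2)] by auto
  moreover have "?T \<inter> {0, 1} \<in> sets lebesgue"
    by (intro negligible_imp_sets negligible_finite) auto
  ultimately have "(?T \<inter> {0<..<1}) \<union> (?T \<inter> {0, 1}) \<in> sets lebesgue"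
    by (rule sets.Un)
  also have "(?T \<inter> {0<..<1}) \<union> (?T \<inter> {0, 1}) = ?T"
    by (auto simp: less_eq_real_def)
  finally show ?thesis .
qed

text \<open>Positivity of the length of an electrode will come from this open set of times: a nonempty
  open set is not negligible, and the speed is positive on it up to finitely many times.\<close>

lemma curve_interval_times_open_subset:
  assumes "simple_path g" "curve_interval g A"
  obtains W where "open W" "W \<noteq> {}" "W \<subseteq> {t \<in> {0..1}. g t \<in> A}"
proof -
  obtain s J where sJ: "s \<in> {0..1}" "J \<subseteq> {0..1}" "interior J \<noteq> {}" "A = shiftpath s g ` J"
    using assms(2) unfolding curve_interval_def by blast
  define W where "W = ((+) s ` interior J \<union> (+) (s - 1) ` interior J) \<inter> {0<..<1}"
  have "interior J \<subseteq> {0<..<1}"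
    using interior_mono[OF sJ(2)] by simp
  have "infinite (interior J)"
    using sJ(3) finite_imp_not_open open_interior by blast
  \<comment> \<open>The parameter \<open>j = 1 - s\<close> belongs to the base point, whose times 0 and 1 are not interior.\<close>
  then have "interior J - {1 - s} \<noteq> {}"
    by (metis finite.emptyI finite_insert finite_Diff2)
  then obtain j where j: "j \<in> interior J" "j \<noteq> 1 - s"
    by blast
  then have "0 < j" "j < 1"
    using \<open>interior J \<subseteq> {0<..<1}\<close> by auto
  then have "s + j \<in> {0<..<1} \<or> s - 1 + j \<in> {0<..<1}"
    using j(2) sJ(1) by auto
  then have "W \<noteq> {}"
    using j(1) by (auto simp: W_def)
  moreover have "open W"
    unfolding W_def by (intro open_Int open_Un open_translation) auto
  moreover have "W \<subseteq> {t \<in> {0..1}. g t \<in> A}"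
    using curve_interval_times[OF assms(1) sJ(1,2)] interior_subset[of J]
    unfolding W_def sJ(4) by blast
  ultimately show thesis
    using that by blast
qed

lemma arclength_pos:
  assumes "polygonal_path g" "simple_path g" "curve_interval g A"
  shows "0 < arclength_integral g A (\<lambda>_. 1)"
proof -
  let ?T = "{t \<in> {0..1}. g t \<in> A}"
  let ?h = "\<lambda>t. norm (vector_derivative g (at t))"
  have "set_integrable lebesgue {0..1} ?h"
    using arclength_integrable[OF assms(1), of "\<lambda>_. 1"] by simp
  then have int: "set_integrable lebesgue ?T ?h"
    by (rule set_integrable_subset)
      (use curve_interval_times_measurable[OF assms(2,3)] in auto)
  obtain S where S: "finite S" "\<And>t. t \<in> {0..1} - S \<Longrightarrow> 0 < ?h t"
    using polygonal_speed_pos[OF assms(1,2)] by metis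
  obtain W where W: "open W" "W \<noteq> {}" "W \<subseteq> ?T"
    using curve_interval_times_open_subset[OF assms(2,3)] by metis
  have "arclength_integral g A (\<lambda>_. 1) \<noteq> 0"
  proof
    assume "arclength_integral g A (\<lambda>_. 1) = 0"
    then have "(\<integral>t. indicator ?T t *\<^sub>R ?h t \<partial>lebesgue) = 0"
      by (simp add: arclength_integral_def set_lebesgue_integral_def)
    then have "AE t in lebesgue. indicator ?T t *\<^sub>R ?h t = 0"
      using int unfolding set_integrable_def
      by (subst (asm) integral_nonneg_eq_0_iff_AE) auto
    then have "negligible {t. indicator ?T t *\<^sub>R ?h t \<noteq> 0}"
      by (simp add: completion.AE_iff_null_sets negligible_iff_null_sets)
    moreover have "W - S \<subseteq> {t. indicator ?T t *\<^sub>R ?h t \<noteq> 0}"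
      using W S(2) by force
    ultimately have "negligible (W - S)"
      using negligible_subset by blast
    moreover have "open (W - S)"
      using W S(1) by (simp add: open_Diff finite_imp_closed)
    moreover have "W - S \<noteq> {}"
      using W S(1) by (metis Diff_eq_empty_iff finite_subset finite_imp_not_open)
    ultimately show False
      using open_not_negligible by blast
  qed
  moreover have "0 \<le> arclength_integral g A (\<lambda>_. 1)"
    unfolding arclength_integral_def set_lebesgue_integral_def
    by (intro integral_nonneg_AE) auto
  ultimately show ?thesis by simp
qed

lemma arclength_integral_nonneg:
  "(\<And>x. x \<in> A \<Longrightarrow> 0 \<le> f x) \<Longrightarrow> 0 \<le> arclength_integral g A f"
  unfolding arclength_integral_def set_lebesgue_integral_def
  by (intro integral_nonneg_AE AE_I2) (auto simp: indicator_def)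

lemma arclength_integral_scale:
  "arclength_integral g A (\<lambda>x. c * f x) = c * arclength_integral g A f"
  unfolding arclength_integral_def by (simp add: mult.assoc)

lemma arclength_integral_cong:
  assumes "\<And>x. x \<in> path_image g \<Longrightarrow> f x = h x"
  shows "arclength_integral g A f = arclength_integral g A h"
  unfolding arclength_integral_def set_lebesgue_integral_def
  by (intro Bochner_Integration.integral_cong refl)
    (auto simp: indicator_def assms path_image_def)

lemma arclength_integral_sum:
  fixes f :: "'i \<Rightarrow> plane \<Rightarrow> real"
  assumes "polygonal_path g" "simple_path g" "curve_interval g A"
    and "\<And>i. i \<in> I \<Longrightarrow> continuous_on (path_image g) (f i)"
  shows "arclength_integral g A (\<lambda>x. \<Sum>i\<in>I. f i x) = (\<Sum>i\<in>I. arclength_integral g A (f i))"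
proof -
  have int: "set_integrable lebesgue {t \<in> {0..1}. g t \<in> A}
      (\<lambda>t. f i (g t) * norm (vector_derivative g (at t)))" if "i \<in> I" for i
    using arclength_integrable[OF assms(1) assms(4)[OF that]]
    by (rule set_integrable_subset)
      (use curve_interval_times_measurable[OF assms(2,3)] in auto)
  show ?thesis
    unfolding arclength_integral_def set_lebesgue_integral_def sum_distrib_right scaleR_sum_right
    by (rule Bochner_Integration.integral_sum) (use int in \<open>simp add: set_integrable_def\<close>)
qed

section \<open>Integrals of cellwise constant functions\<close>

lemma conforming_mesh_triangles:
  assumes "conforming_mesh \<Omega> K p"
  shows "open (K \<nu>)" "K \<nu> \<noteq> {}" "convex (closure (K \<nu>))" "compact (closure (K \<nu>))"
    "interior (closure (K \<nu>)) = K \<nu>"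
proof -
  obtain T where T: "2 simplex T" "K \<nu> = interior T"
    using assms unfolding conforming_mesh_def by metis
  have "convex T" "closed T" "compact T"
    using T(1) by (simp_all add: convex_simplex closed_simplex compact_simplex)
  have "aff_dim T = DIM(plane)"
    using aff_dim_simplex[OF T(1)] by simp
  then have "affine hull T = UNIV"
    by (simp only: aff_dim_eq_full)
  moreover have "T \<noteq> {}"
    using \<open>affine hull T = UNIV\<close> by auto
  ultimately show ne: "K \<nu> \<noteq> {}"
    using \<open>convex T\<close> T(2) by (metis rel_interior_eq_empty rel_interior_interior)
  have "closure (K \<nu>) = T"
    using convex_closure_interior[OF \<open>convex T\<close>] ne T(2) \<open>closed T\<close> by simp
  then show "convex (closure (K \<nu>))" "compact (closure (K \<nu>))" "interior (closure (K \<nu>)) = K \<nu>"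
      "open (K \<nu>)"
    using \<open>convex T\<close> \<open>compact T\<close> T(2) by auto
qed

text \<open>The intersection of two closed triangles is a face of both. A proper face misses the interior,
  so overlapping open triangles would have equal closures.\<close>

lemma conforming_mesh_disjoint:
  assumes "conforming_mesh \<Omega> K p" "\<nu> \<noteq> \<mu>"
  shows "K \<nu> \<inter> K \<mu> = {}"
proof (rule ccontr)
  assume meet: "K \<nu> \<inter> K \<mu> \<noteq> {}"
  note tri = conforming_mesh_triangles[OF assms(1)]
  let ?T = "\<lambda>\<nu>. closure (K \<nu>)"
  have face: "?T \<nu> \<inter> ?T \<mu> face_of ?T \<nu>" for \<nu> \<mu>
    using assms(1) unfolding conforming_mesh_def triangulation_def by blast
  have "?T \<nu> \<inter> ?T \<mu> = ?T \<nu>" if "K \<nu> \<inter> K \<mu> \<noteq> {}" for \<nu> \<mu>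
    using face_of_disjoint_interior[OF face[of \<nu> \<mu>]] tri(5)[of \<nu>] closure_subset[of "K \<nu>"]
      closure_subset[of "K \<mu>"] that by blast
  from this[of \<nu> \<mu>] this[of \<mu> \<nu>] meet have "?T \<nu> = ?T \<mu>"
    by blast
  then have "K \<nu> = K \<mu>"
    using tri(5) by metis
  then show False
    using assms unfolding conforming_mesh_def by (meson injD)
qed

lemma conforming_mesh_skeleton_negligible:
  assumes "conforming_mesh \<Omega> K p"
  shows "negligible (closure \<Omega> - (\<Union>\<nu>. K \<nu>))"
proof (rule negligible_subset)
  note tri = conforming_mesh_triangles[OF assms]
  show "negligible (\<Union>\<nu>. frontier (closure (K \<nu>)))"
    by (intro negligible_Union) (auto intro: negligible_convex_frontier tri)
  have "closure \<Omega> = (\<Union>\<nu>. closure (K \<nu>))"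
    using assms unfolding conforming_mesh_def by blast
  then show "closure \<Omega> - (\<Union>\<nu>. K \<nu>) \<subseteq> (\<Union>\<nu>. frontier (closure (K \<nu>)))"
    by (auto simp: frontier_def tri(5))
qed

text \<open>The function \<open>f\<close> is arbitrary off the open cells, where pointwise gradients carry no information.
  Its measurability there comes from the completeness of Lebesgue measure. A cell enters through
  \<open>\<Omega> \<inter> K \<nu>\<close>, which avoids comparing \<open>\<Omega>\<close> with the interior of its closure.\<close>

lemma set_integral_piecewise_constant:
  fixes K :: "'t::finite \<Rightarrow> plane set"
  assumes "open \<Omega>" "bounded \<Omega>" "negligible (closure \<Omega> - (\<Union>\<nu>. K \<nu>))" "\<And>\<nu>. open (K \<nu>)"
    and "\<And>\<nu> \<mu>. \<nu> \<noteq> \<mu> \<Longrightarrow> K \<nu> \<inter> K \<mu> = {}"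
    and const: "\<And>\<nu> x. x \<in> K \<nu> \<Longrightarrow> f x = c \<nu>"
  shows "(LINT x:\<Omega>|lebesgue. f x) = (\<Sum>\<nu>\<in>UNIV. c \<nu> * measure lebesgue (\<Omega> \<inter> K \<nu>))"
proof -
  define h where "h x = (\<Sum>\<nu>\<in>UNIV. c \<nu> * indicat_real (K \<nu>) x)" for x
  have fin: "\<Omega> \<inter> K \<nu> \<in> lmeasurable" for \<nu>
    using assms(1,2,4) by (intro lmeasurable_open bounded_Int) auto
  have int: "integrable lebesgue (\<lambda>x. c \<nu> * indicat_real (\<Omega> \<inter> K \<nu>) x)" for \<nu>
    using fin[of \<nu>] by (intro integrable_mult_right integrable_real_indicator)
      (auto simp: fmeasurable_def)
  have h: "indicator \<Omega> x *\<^sub>R h x = (\<Sum>\<nu>\<in>UNIV. c \<nu> * indicat_real (\<Omega> \<inter> K \<nu>) x)" for x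
    unfolding h_def indicator_inter_arith by (simp only: real_scaleR_def sum_distrib_left mult_ac)
  have h_int: "set_integrable lebesgue \<Omega> h"
    unfolding set_integrable_def h by (intro Bochner_Integration.integrable_sum int)
  have eq: "f x = h x" if x: "x \<in> \<Omega> - (closure \<Omega> - (\<Union>\<nu>. K \<nu>))" for x
  proof -
    obtain \<nu> where \<nu>: "x \<in> K \<nu>"
      using x closure_subset[of \<Omega>] by blast
    have "x \<in> K \<mu> \<longleftrightarrow> \<mu> = \<nu>" for \<mu>
      using assms(5)[of \<mu> \<nu>] \<nu> by blast
    then have "h x = c \<nu>"
      by (simp add: h_def indicator_def)
    then show ?thesis
      using const[OF \<nu>] by simp
  qed
  have f_int: "set_integrable lebesgue \<Omega> f"
    by (rule absolutely_integrable_spike[OF h_int assms(3)]) (use eq in auto)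
  have "(LINT x:\<Omega>|lebesgue. f x) = integral \<Omega> f"
    by (rule set_lebesgue_integral_eq_integral[OF f_int])
  also have "\<dots> = integral \<Omega> h"
    by (rule integral_spike[OF assms(3)]) (use eq in auto)
  also have "\<dots> = (LINT x:\<Omega>|lebesgue. h x)"
    by (rule set_lebesgue_integral_eq_integral(2)[OF h_int, symmetric])
  also have "\<dots> = (\<integral>x. (\<Sum>\<nu>\<in>UNIV. c \<nu> * indicat_real (\<Omega> \<inter> K \<nu>) x) \<partial>lebesgue)"
    unfolding set_lebesgue_integral_def h ..
  also have "\<dots> = (\<Sum>\<nu>\<in>UNIV. \<integral>x. c \<nu> * indicat_real (\<Omega> \<inter> K \<nu>) x \<partial>lebesgue)"
    by (intro Bochner_Integration.integral_sum int)
  also have "\<dots> = (\<Sum>\<nu>\<in>UNIV. c \<nu> * measure lebesgue (\<Omega> \<inter> K \<nu>))"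
    by simp
  finally show ?thesis .
qed

section \<open>Positive definiteness of the stiffness matrix\<close>

lemma sum_univ_plus:
  fixes f :: "'a::finite + 'b::finite \<Rightarrow> 'c::comm_monoid_add"
  shows "(\<Sum>i\<in>UNIV. f i) = (\<Sum>a\<in>UNIV. f (Inl a)) + (\<Sum>b\<in>UNIV. f (Inr b))"
  unfolding UNIV_Plus_UNIV[symmetric] Plus_def
  by (subst sum.union_disjoint) (auto simp: sum.reindex)

locale cem_discretization =
  fixes \<Omega> :: "plane set" and g :: "real \<Rightarrow> plane"
    and K :: "'t::finite \<Rightarrow> plane set" and p :: "'v::finite \<Rightarrow> plane"
    and \<psi> :: "'v \<Rightarrow> plane \<Rightarrow> real"
    and E :: "'l::finite \<Rightarrow> plane set" and z :: "'l \<Rightarrow> real"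
    and \<E> :: "'m::finite \<Rightarrow> real ^ 'l"
  assumes domain: "polygonal_domain \<Omega> g" and mesh: "conforming_mesh \<Omega> K p"
    and lagrange: "lagrange_basis K p \<psi>" and electr: "electrodes g E"
    and z_pos: "\<forall>l. z l > 0" and basis: "orthonormal_basis_mean_free \<E>"
begin

lemmas triangles = conforming_mesh_triangles[OF mesh]

lemma curve: "polygonal_path g" "simple_path g" "path_image g = frontier \<Omega>"
  and domain': "open \<Omega>" "bounded \<Omega>" "connected \<Omega>"
  using domain unfolding polygonal_domain_def by auto

lemma electrode: "curve_interval g (E l)"
  using electr unfolding electrodes_def by blast

lemma closure_domain: "closure \<Omega> = (\<Union>\<nu>. closure (K \<nu>))"
  using mesh unfolding conforming_mesh_def by blast

text \<open>The gradient of the potential of a basis pair on one cell. An affine function on a nonempty open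
  set has only one gradient, so the choice is unique; see \<open>basis_gradient\<close>.\<close>

definition slope :: "'v + 'm \<Rightarrow> 't \<Rightarrow> plane" where
  "slope i \<nu> = (case i of Inl j \<Rightarrow> (SOME a. \<exists>c. \<forall>x\<in>closure (K \<nu>). \<psi> j x = a \<bullet> x + c) | Inr _ \<Rightarrow> 0)"

text \<open>This is the factor \<open>u - U\<^sub>l\<close> in the electrode term of the bilinear form.\<close>

definition jump :: "'l \<Rightarrow> 'v + 'm \<Rightarrow> plane \<Rightarrow> real" where
  "jump l i x = fst (cem_basis \<psi> \<E> i) x - snd (cem_basis \<psi> \<E> i) $ l"

lemma basis_affine: "\<exists>c. \<forall>x\<in>closure (K \<nu>). fst (cem_basis \<psi> \<E> i) x = slope i \<nu> \<bullet> x + c"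
proof (cases i)
  case (Inl j)
  have "\<exists>a c. \<forall>x\<in>closure (K \<nu>). \<psi> j x = a \<bullet> x + c"
    using lagrange unfolding lagrange_basis_def by blast
  from someI_ex[OF this] show ?thesis
    by (simp add: Inl slope_def cem_basis_def)
next
  case (Inr m)
  then show ?thesis
    by (simp add: slope_def cem_basis_def)
qed

lemma basis_gradient:
  assumes "x \<in> K \<nu>"
  shows "gradient (fst (cem_basis \<psi> \<E> i)) x = slope i \<nu>"
proof -
  obtain c where c: "\<And>x. x \<in> closure (K \<nu>) \<Longrightarrow> fst (cem_basis \<psi> \<E> i) x = slope i \<nu> \<bullet> x + c"
    using basis_affine[of \<nu> i] by blast
  have "((\<lambda>x. slope i \<nu> \<bullet> x + c) has_derivative (\<lambda>h. slope i \<nu> \<bullet> h)) (at x)"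
    by (auto intro!: derivative_eq_intros)
  then have "(fst (cem_basis \<psi> \<E> i) has_derivative (\<lambda>h. slope i \<nu> \<bullet> h)) (at x)"
    by (rule has_derivative_transform_within_open[of _ _ _ _ "K \<nu>"])
      (use assms triangles(1) closure_subset[of "K \<nu>"] c in auto)
  then have "frechet_derivative (fst (cem_basis \<psi> \<E> i)) (at x) = (\<lambda>h. slope i \<nu> \<bullet> h)"
    by (rule frechet_derivative_at[symmetric])
  then show ?thesis
    by (simp add: gradient_def vec_eq_iff inner_axis)
qed

lemma basis_continuous: "continuous_on (closure \<Omega>) (fst (cem_basis \<psi> \<E> i))"
  unfolding closure_domain
proof (rule continuous_on_closed_Union)
  fix \<nu>
  obtain c where "\<And>x. x \<in> closure (K \<nu>) \<Longrightarrow> fst (cem_basis \<psi> \<E> i) x = slope i \<nu> \<bullet> x + c"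
    using basis_affine[of \<nu> i] by blast
  then show "continuous_on (closure (K \<nu>)) (fst (cem_basis \<psi> \<E> i))"
    by (subst continuous_on_cong[OF refl]) (auto intro!: continuous_intros)
qed auto

lemma jump_continuous: "continuous_on (path_image g) (jump l i)"
  unfolding jump_def curve(3)
  by (intro continuous_on_diff continuous_on_const continuous_on_subset[OF basis_continuous])
    (simp add: frontier_def)

text \<open>The entries of the stiffness matrix after integration over the cells: in this form their affine
  dependence on the cell values \<open>s\<close> of the conductivity is visible.\<close>

definition cell_stiffness :: "('t \<Rightarrow> real) \<Rightarrow> real ^ ('v + 'm) ^ ('v + 'm)" where
  "cell_stiffness s = (\<chi> j k. (\<Sum>\<nu>\<in>UNIV. s \<nu> * (slope j \<nu> \<bullet> slope k \<nu>) * measure lebesgue (\<Omega> \<inter> K \<nu>))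
     + (\<Sum>l\<in>UNIV. 1 / z l * arclength_integral g (E l) (\<lambda>x. jump l j x * jump l k x)))"

lemma stiffness_matrix_piecewise_constant:
  assumes "\<And>\<nu> x. x \<in> K \<nu> \<Longrightarrow> \<sigma> x = s \<nu>"
  shows "stiffness_matrix \<Omega> g E z \<psi> \<E> \<sigma> = cell_stiffness s"
proof -
  have "(LINT x:\<Omega>|lebesgue. \<sigma> x * (gradient (fst (cem_basis \<psi> \<E> j)) x
        \<bullet> gradient (fst (cem_basis \<psi> \<E> k)) x))
      = (\<Sum>\<nu>\<in>UNIV. s \<nu> * (slope j \<nu> \<bullet> slope k \<nu>) * measure lebesgue (\<Omega> \<inter> K \<nu>))" for j k
    by (rule set_integral_piecewise_constant)
      (use domain' mesh assms in \<open>auto simp: conforming_mesh_skeleton_negligible triangles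
        conforming_mesh_disjoint basis_gradient\<close>)
  then show ?thesis
    by (simp add: stiffness_matrix_def cell_stiffness_def cem_form_def jump_def split_def vec_eq_iff)
qed

lemma cell_stiffness_symmetric: "transpose (cell_stiffness s) = cell_stiffness s"
  by (simp add: transpose_def cell_stiffness_def vec_eq_iff inner_commute mult.commute)

definition slope_of :: "real ^ ('v + 'm) \<Rightarrow> 't \<Rightarrow> plane" where
  "slope_of c \<nu> = (\<Sum>i\<in>UNIV. c $ i *\<^sub>R slope i \<nu>)"

definition jump_of :: "real ^ ('v + 'm) \<Rightarrow> 'l \<Rightarrow> plane \<Rightarrow> real" where
  "jump_of c l x = (\<Sum>i\<in>UNIV. c $ i * jump l i x)"

text \<open>The quadratic form is a sum of squares: the energy in the cells and the losses at the electrodes.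
  Both the monotone dependence on \<open>s\<close> and positive definiteness are read off from it.\<close>

lemma cell_stiffness_form:
  "c \<bullet> (cell_stiffness s *v c) =
     (\<Sum>\<nu>\<in>UNIV. s \<nu> * measure lebesgue (\<Omega> \<inter> K \<nu>) * (norm (slope_of c \<nu>))\<^sup>2) +
     (\<Sum>l\<in>UNIV. 1 / z l * arclength_integral g (E l) (\<lambda>x. (jump_of c l x)\<^sup>2))"
proof -
  let ?q = "\<lambda>i j \<nu>. slope i \<nu> \<bullet> slope j \<nu>"
  let ?w = "\<lambda>\<nu>. measure lebesgue (\<Omega> \<inter> K \<nu>)"
  let ?a = "\<lambda>l i j. arclength_integral g (E l) (\<lambda>x. jump l i x * jump l j x)"
  have quad: "(norm (slope_of c \<nu>))\<^sup>2 = (\<Sum>i\<in>UNIV. \<Sum>j\<in>UNIV. c $ i * c $ j * ?q i j \<nu>)" for \<nu>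
    by (simp add: slope_of_def power2_norm_eq_inner inner_sum_left inner_sum_right
        sum_distrib_left mult_ac inner_commute)
  have bd: "arclength_integral g (E l) (\<lambda>x. (jump_of c l x)\<^sup>2)
      = (\<Sum>i\<in>UNIV. \<Sum>j\<in>UNIV. c $ i * c $ j * ?a l i j)" for l
  proof -
    have "(\<lambda>x. (jump_of c l x)\<^sup>2)
        = (\<lambda>x. \<Sum>i\<in>UNIV. \<Sum>j\<in>UNIV. (c $ i * c $ j) * (jump l i x * jump l j x))"
      by (simp add: jump_of_def power2_eq_square sum_product mult_ac)
    then show ?thesis
      by (simp only: arclength_integral_sum[OF curve(1,2) electrode] arclength_integral_scale
          continuous_on_sum continuous_on_mult continuous_on_const jump_continuous)
  qed
  have "c \<bullet> (cell_stiffness s *v c) = (\<Sum>i\<in>UNIV. \<Sum>j\<in>UNIV. c $ i * c $ j * cell_stiffness s $ i $ j)"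
    by (simp add: inner_vec_def matrix_vector_mult_def sum_distrib_left mult_ac)
  also have "\<dots> = (\<Sum>i\<in>UNIV. \<Sum>j\<in>UNIV. (\<Sum>\<nu>\<in>UNIV. s \<nu> * ?w \<nu> * (c $ i * c $ j * ?q i j \<nu>))
      + (\<Sum>l\<in>UNIV. 1 / z l * (c $ i * c $ j * ?a l i j)))"
    by (simp add: cell_stiffness_def distrib_left sum_distrib_left mult_ac)
  also have "\<dots> = (\<Sum>i\<in>UNIV. \<Sum>j\<in>UNIV. \<Sum>\<nu>\<in>UNIV. s \<nu> * ?w \<nu> * (c $ i * c $ j * ?q i j \<nu>))
      + (\<Sum>i\<in>UNIV. \<Sum>j\<in>UNIV. \<Sum>l\<in>UNIV. 1 / z l * (c $ i * c $ j * ?a l i j))"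
    by (simp only: sum.distrib)
  also have "(\<Sum>i\<in>UNIV. \<Sum>j\<in>UNIV. \<Sum>\<nu>\<in>UNIV. s \<nu> * ?w \<nu> * (c $ i * c $ j * ?q i j \<nu>))
      = (\<Sum>\<nu>\<in>UNIV. s \<nu> * ?w \<nu> * (norm (slope_of c \<nu>))\<^sup>2)"
    unfolding quad sum_distrib_left sum.swap[of _ "UNIV :: 't set"] ..
  also have "(\<Sum>i\<in>UNIV. \<Sum>j\<in>UNIV. \<Sum>l\<in>UNIV. 1 / z l * (c $ i * c $ j * ?a l i j))
      = (\<Sum>l\<in>UNIV. 1 / z l * arclength_integral g (E l) (\<lambda>x. (jump_of c l x)\<^sup>2))"
    unfolding bd sum_distrib_left sum.swap[of _ "UNIV :: 'l set"] ..
  finally show ?thesis .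
qed

definition potential :: "real ^ ('v + 'm) \<Rightarrow> plane \<Rightarrow> real" where
  "potential c x = (\<Sum>i\<in>UNIV. c $ i * fst (cem_basis \<psi> \<E> i) x)"

definition voltages :: "real ^ ('v + 'm) \<Rightarrow> real ^ 'l" where
  "voltages c = (\<Sum>i\<in>UNIV. c $ i *\<^sub>R snd (cem_basis \<psi> \<E> i))"

lemma jump_of_eq: "jump_of c l x = potential c x - voltages c $ l"
  by (simp add: jump_of_def jump_def potential_def voltages_def right_diff_distrib sum_subtractf)

lemma potential_vertex: "potential c (p k) = c $ Inl k"
proof -
  have "\<psi> j (p k) = (if j = k then 1 else 0)" for j
    using lagrange unfolding lagrange_basis_def by blast
  then have "(\<Sum>j\<in>UNIV. c $ Inl j * \<psi> j (p k)) = (\<Sum>j\<in>UNIV. if j = k then c $ Inl j else 0)"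
    by (intro sum.cong refl) simp
  then show ?thesis
    by (simp add: potential_def sum_univ_plus cem_basis_def)
qed

lemma voltages_eq: "voltages c = (\<Sum>m\<in>UNIV. c $ Inr m *\<^sub>R \<E> m)"
  by (simp add: voltages_def sum_univ_plus cem_basis_def)

lemma voltages_coefficient: "voltages c \<bullet> \<E> m = c $ Inr m"
proof -
  have "\<E> k \<bullet> \<E> m = (if k = m then 1 else 0)" for k
    using basis unfolding orthonormal_basis_mean_free_def by blast
  then have "(\<Sum>k\<in>UNIV. c $ Inr k * (\<E> k \<bullet> \<E> m)) = (\<Sum>k\<in>UNIV. if k = m then c $ Inr k else 0)"
    by (intro sum.cong refl) simp
  then show ?thesis
    by (simp add: voltages_eq inner_sum_left)
qed

lemma voltages_mean_free: "(\<Sum>l\<in>UNIV. voltages c $ l) = 0"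
proof -
  have "voltages c \<in> span (range \<E>)"
    unfolding voltages_eq by (intro span_sum span_scale span_base) auto
  then show ?thesis
    using basis unfolding orthonormal_basis_mean_free_def by auto
qed

text \<open>A potential with vanishing slopes takes at most one value per cell, hence finitely many values on
  the connected set \<open>closure \<Omega>\<close>, where it is continuous.\<close>

lemma potential_constant:
  assumes "\<And>\<nu>. slope_of c \<nu> = 0"
  shows "\<exists>r. \<forall>x\<in>closure \<Omega>. potential c x = r"
proof -
  have "\<exists>r. \<forall>x\<in>closure (K \<nu>). potential c x = r" for \<nu>
  proof -
    have "\<exists>b. \<forall>i. \<forall>x\<in>closure (K \<nu>). fst (cem_basis \<psi> \<E> i) x = slope i \<nu> \<bullet> x + b i"
      by (rule choice) (intro allI basis_affine)
    then obtain b where b: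
        "\<And>i x. x \<in> closure (K \<nu>) \<Longrightarrow> fst (cem_basis \<psi> \<E> i) x = slope i \<nu> \<bullet> x + b i"
      by blast
    have "potential c x = (\<Sum>i\<in>UNIV. c $ i * b i)" if "x \<in> closure (K \<nu>)" for x
    proof -
      have "potential c x = slope_of c \<nu> \<bullet> x + (\<Sum>i\<in>UNIV. c $ i * b i)"
        using that by (simp add: potential_def slope_of_def b distrib_left sum.distrib inner_sum_left)
      then show ?thesis
        using assms by simp
    qed
    then show ?thesis by blast
  qed
  then have "\<forall>\<nu>. \<exists>r. \<forall>x\<in>closure (K \<nu>). potential c x = r" ..
  from choice[OF this] obtain r where
      r: "\<And>\<nu> x. x \<in> closure (K \<nu>) \<Longrightarrow> potential c x = r \<nu>"
    by blast
  have "potential c ` closure \<Omega> \<subseteq> range r"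
  proof (rule image_subsetI)
    fix x assume "x \<in> closure \<Omega>"
    then obtain \<nu> where "x \<in> closure (K \<nu>)"
      unfolding closure_domain by blast
    then show "potential c x \<in> range r"
      using r[of x \<nu>] by simp
  qed
  then have "finite (potential c ` closure \<Omega>)"
    by (rule finite_subset) simp
  moreover have "continuous_on (closure \<Omega>) (potential c)"
    unfolding potential_def by (intro continuous_intros basis_continuous)
  moreover have "connected (closure \<Omega>)"
    using domain'(3) by (rule connected_imp_connected_closure)
  ultimately have "potential c constant_on closure \<Omega>"
    by (intro continuous_finite_range_constant)
  then show ?thesis
    unfolding constant_on_def by blast
qed

lemma vertex_in_closure: "p k \<in> closure \<Omega>"
proof -
  have "p k \<in> {x. \<exists>\<nu>. x extreme_point_of closure (K \<nu>)}"
    using mesh unfolding conforming_mesh_def bij_betw_def by blast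
  then show ?thesis
    by (auto simp: closure_domain extreme_point_of_def)
qed

text \<open>If the form vanishes, then so do all slopes, because every cell meets \<open>\<Omega>\<close> in a set of positive
  measure. The potential is a constant \<open>r\<close>. Every electrode has positive length, so all electrode
  voltages equal \<open>r\<close> as well; being mean free, they vanish and \<open>r = 0\<close>. The values at the mesh
  vertices and the scalar products with the basis \<open>\<E>\<close> recover the coefficients, which are zero.\<close>

lemma pos_def_cell_stiffness:
  assumes s: "\<And>\<nu>. s \<nu> > 0"
  shows "pos_def (cell_stiffness s)"
  unfolding pos_def_def
proof (intro conjI allI impI cell_stiffness_symmetric)
  fix c :: "real ^ ('v + 'm)"
  assume "c \<noteq> 0"
  let ?A = "\<lambda>\<nu>. s \<nu> * measure lebesgue (\<Omega> \<inter> K \<nu>) * (norm (slope_of c \<nu>))\<^sup>2"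
  let ?B = "\<lambda>l. 1 / z l * arclength_integral g (E l) (\<lambda>x. (jump_of c l x)\<^sup>2)"
  have A: "0 \<le> ?A \<nu>" for \<nu>
    using s[of \<nu>] by simp
  have B: "0 \<le> ?B l" for l
    using z_pos by (intro mult_nonneg_nonneg arclength_integral_nonneg) (auto simp: less_imp_le)
  have "c \<bullet> (cell_stiffness s *v c) \<noteq> 0"
  proof
    assume zero: "c \<bullet> (cell_stiffness s *v c) = 0"
    have "sum ?A UNIV = 0 \<and> sum ?B UNIV = 0"
      using zero unfolding cell_stiffness_form
      by (subst (asm) add_nonneg_eq_0_iff) (blast intro: sum_nonneg A B)+
    then have A0: "?A \<nu> = 0" and B0: "?B l = 0" for \<nu> l
      using A B by (simp_all only: sum_nonneg_eq_0_iff finite UNIV_I ball_UNIV)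
    have "slope_of c \<nu> = 0" for \<nu>
    proof -
      have "K \<nu> \<subseteq> closure \<Omega>"
        using closure_subset by (auto simp: closure_domain)
      then have "\<Omega> \<inter> K \<nu> \<noteq> {}"
        using triangles(1,2)[of \<nu>] by (metis Int_commute inf.absorb1 open_Int_closure_eq_empty)
      then have "\<not> negligible (\<Omega> \<inter> K \<nu>)"
        using triangles(1) domain'(1) by (intro open_not_negligible) auto
      moreover have "\<Omega> \<inter> K \<nu> \<in> lmeasurable"
        using triangles(1) domain' by (intro lmeasurable_open bounded_Int) auto
      ultimately have "measure lebesgue (\<Omega> \<inter> K \<nu>) \<noteq> 0"
        by (simp add: negligible_iff_measure)
      then show ?thesis
        using A0[of \<nu>] s[of \<nu>] by simp
    qed
    then have "\<exists>r. \<forall>x\<in>closure \<Omega>. potential c x = r"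
      by (rule potential_constant)
    then obtain r where r: "\<And>x. x \<in> closure \<Omega> \<Longrightarrow> potential c x = r"
      by blast
    have "voltages c $ l = r" for l
    proof -
      have "arclength_integral g (E l) (\<lambda>x. (jump_of c l x)\<^sup>2)
          = arclength_integral g (E l) (\<lambda>x. (r - voltages c $ l)\<^sup>2 * 1)"
        by (rule arclength_integral_cong)
          (auto simp: jump_of_eq r curve(3) frontier_def)
      also have "\<dots> = (r - voltages c $ l)\<^sup>2 * arclength_integral g (E l) (\<lambda>x. 1)"
        by (rule arclength_integral_scale)
      finally show ?thesis
        using B0[of l] z_pos arclength_pos[OF curve(1,2) electrode[of l]]
        by (auto simp: less_le)
    qed
    then have "r = 0" "voltages c = 0"
      using voltages_mean_free[of c] by (simp_all add: vec_eq_iff)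
    have "c $ Inl k = 0" for k
      using potential_vertex[of c k] r[OF vertex_in_closure[of k]] \<open>r = 0\<close> by simp
    moreover have "c $ Inr m = 0" for m
      using voltages_coefficient[of c m] \<open>voltages c = 0\<close> by simp
    ultimately have "c $ i = 0" for i
      by (cases i) auto
    with \<open>c \<noteq> 0\<close> show False
      by (simp add: vec_eq_iff)
  qed
  moreover have "0 \<le> c \<bullet> (cell_stiffness s *v c)"
    unfolding cell_stiffness_form by (intro add_nonneg_nonneg sum_nonneg A B)
  ultimately show "0 < c \<bullet> (cell_stiffness s *v c)"
    by simp
qed

lemma cell_stiffness_mono:
  assumes "\<And>\<nu>. s \<nu> \<le> s' \<nu>"
  shows "c \<bullet> (cell_stiffness s *v c) \<le> c \<bullet> (cell_stiffness s' *v c)"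
  unfolding cell_stiffness_form by (intro add_right_mono sum_mono mult_right_mono assms) auto

lemma cell_stiffness_affine:
  assumes "u + v = 1"
  shows "cell_stiffness (\<lambda>\<nu>. u * s \<nu> + v * s' \<nu>) = u *\<^sub>R cell_stiffness s + v *\<^sub>R cell_stiffness s'"
proof -
  have v: "v = 1 - u"
    using assms by simp
  show ?thesis
    unfolding v by (simp add: cell_stiffness_def vec_eq_iff sum.distrib sum_distrib_left sum_subtractf algebra_simps)
qed

end

section \<open>Convexity of the misfit and of the Gibbs energy\<close>

context cem_discretization
begin

definition cell_conductivity :: "('n::finite \<Rightarrow> 't) \<Rightarrow> real \<Rightarrow> real ^ 'n \<Rightarrow> 't \<Rightarrow> real" where
  "cell_conductivity d \<sigma>0 \<xi> \<nu> = \<sigma>0 + (\<Sum>\<mu>\<in>UNIV. \<xi> $ \<mu> * of_bool (d \<mu> = \<nu>))"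

lemma conductivity_on_cell:
  assumes "x \<in> K \<nu>"
  shows "conductivity K d \<sigma>0 \<xi> x = cell_conductivity d \<sigma>0 \<xi> \<nu>"
proof -
  have "x \<in> K \<mu> \<longleftrightarrow> \<mu> = \<nu>" for \<mu>
    using conforming_mesh_disjoint[OF mesh, of \<mu> \<nu>] assms by blast
  then show ?thesis
    by (simp add: conductivity_def cell_conductivity_def indicator_def of_bool_def)
qed

lemma cell_conductivity_pos:
  assumes "inj d" "0 < \<sigma>0" "\<And>\<mu>. 0 < \<sigma>0 + \<xi> $ \<mu>"
  shows "0 < cell_conductivity d \<sigma>0 \<xi> \<nu>"
proof (cases "\<nu> \<in> range d")
  case True
  then obtain \<mu> where "\<nu> = d \<mu>"
    by blast
  then have "\<xi> $ \<kappa> * of_bool (d \<kappa> = \<nu>) = (if \<kappa> = \<mu> then \<xi> $ \<kappa> else 0)" for \<kappa>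
    using assms(1) by (auto dest: injD)
  then show ?thesis
    using assms(3) by (simp add: cell_conductivity_def)
next
  case False
  then have "of_bool (d \<kappa> = \<nu>) = (0 :: real)" for \<kappa>
    by auto
  then show ?thesis
    using assms(2) by (simp add: cell_conductivity_def)
qed

lemma cell_conductivity_mono:
  "(\<And>\<mu>. \<xi> $ \<mu> \<le> \<xi>' $ \<mu>) \<Longrightarrow> cell_conductivity d \<sigma>0 \<xi> \<nu> \<le> cell_conductivity d \<sigma>0 \<xi>' \<nu>"
  unfolding cell_conductivity_def by (intro add_left_mono sum_mono mult_right_mono) auto

lemma cell_conductivity_affine:
  assumes "u + v = 1"
  shows "cell_conductivity d \<sigma>0 (u *\<^sub>R \<xi> + v *\<^sub>R \<xi>') =
    (\<lambda>\<nu>. u * cell_conductivity d \<sigma>0 \<xi> \<nu> + v * cell_conductivity d \<sigma>0 \<xi>' \<nu>)"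
proof
  fix \<nu>
  have sum: "(\<Sum>\<mu>\<in>UNIV. (u *\<^sub>R \<xi> + v *\<^sub>R \<xi>') $ \<mu> * of_bool (d \<mu> = \<nu>)) =
      u * (\<Sum>\<mu>\<in>UNIV. \<xi> $ \<mu> * of_bool (d \<mu> = \<nu>)) + v * (\<Sum>\<mu>\<in>UNIV. \<xi>' $ \<mu> * of_bool (d \<mu> = \<nu>))"
    by (simp only: vector_add_component vector_scaleR_component real_scaleR_def distrib_right
        sum.distrib sum_distrib_left mult.assoc)
  have "\<sigma>0 = u * \<sigma>0 + v * \<sigma>0"
    using assms by (metis distrib_right mult_1)
  then show "cell_conductivity d \<sigma>0 (u *\<^sub>R \<xi> + v *\<^sub>R \<xi>') \<nu> =
      u * cell_conductivity d \<sigma>0 \<xi> \<nu> + v * cell_conductivity d \<sigma>0 \<xi>' \<nu>"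
    unfolding cell_conductivity_def sum distrib_left by linarith
qed

text \<open>The constraint \<open>\<xi> \<le> \<xi>s\<close> enters here: since \<open>alpha\<close> is decreasing in the conductivity, it
  makes \<open>alpha\<close> at \<open>\<xi>\<close> minus \<open>alpha\<close> at \<open>\<xi>s\<close> positive semidefinite. As a function of \<open>\<xi>\<close> this
  difference is matrix-convex, and its Frobenius norm is the misfit.\<close>

lemma convex_on_misfit:
  fixes d :: "'n::finite \<Rightarrow> 't" and \<xi>s :: "real ^ 'n"
  assumes d: "inj d" and pos: "0 < \<sigma>0" "\<And>\<mu>. 0 < \<sigma>0 + \<xi>s $ \<mu>"
  defines "F \<equiv> forward_map \<Omega> g E z \<psi> \<E> K d \<sigma>0"
  shows "convex_on {\<xi>. \<forall>\<mu>. - \<sigma>0 < \<xi> $ \<mu> \<and> \<xi> $ \<mu> \<le> \<xi>s $ \<mu>} (\<lambda>\<xi>. (norm (F \<xi>s - F \<xi>))\<^sup>2)"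
    (is "convex_on ?X _")
proof -
  define M where "M \<xi> = cell_stiffness (cell_conductivity d \<sigma>0 \<xi>)" for \<xi>
  have F: "F \<xi> = vec_columns ((\<chi> l m. \<E> m $ l) ** alpha (M \<xi>))" for \<xi>
    unfolding F_def forward_map_def M_def
    by (subst stiffness_matrix_piecewise_constant) (auto intro: conductivity_on_cell)
  have misfit: "norm (F \<xi>s - F \<xi>) = norm (alpha (M \<xi>) - alpha (M \<xi>s))" for \<xi>
  proof -
    have "F \<xi>s - F \<xi> = vec_columns ((\<chi> l m. \<E> m $ l) ** (alpha (M \<xi>s) - alpha (M \<xi>)))"
      by (simp add: F vec_columns_def vec_eq_iff matrix_matrix_mult_def right_diff_distrib
          sum_subtractf)
    then show ?thesis
      using norm_vec_columns_isometry[OF basis] by (metis norm_minus_commute)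
  qed
  have pd: "pos_def (M \<xi>)" if "\<And>\<mu>. 0 < \<sigma>0 + \<xi> $ \<mu>" for \<xi>
    unfolding M_def by (intro pos_def_cell_stiffness cell_conductivity_pos d pos(1) that)
  have affine: "M (u *\<^sub>R \<xi> + v *\<^sub>R \<xi>') = u *\<^sub>R M \<xi> + v *\<^sub>R M \<xi>'" if "u + v = 1" for u v \<xi> \<xi>'
    unfolding M_def cell_conductivity_affine[OF that] by (rule cell_stiffness_affine[OF that])
  have pdX: "pos_def (M \<xi>)" if "\<xi> \<in> ?X" for \<xi>
  proof (rule pd)
    fix \<mu>
    have "- \<sigma>0 < \<xi> $ \<mu>"
      using that by blast
    then show "0 < \<sigma>0 + \<xi> $ \<mu>"
      by linarith
  qed
  have X: "convex ?X"
  proof -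
    have "?X = (\<Inter>\<mu>. {\<xi>. - \<sigma>0 < axis \<mu> 1 \<bullet> \<xi>} \<inter> {\<xi>. axis \<mu> 1 \<bullet> \<xi> \<le> \<xi>s $ \<mu>})"
      by (auto simp: inner_axis')
    then show ?thesis
      by (auto intro!: convex_INT convex_Int convex_halfspace_le convex_halfspace_gt)
  qed
  have "convex_on ?X (\<lambda>\<xi>. (norm (alpha (M \<xi>) - alpha (M \<xi>s)))\<^sup>2)"
  proof (rule convex_on_norm_sq_psd[OF X])
    fix \<xi> assume \<xi>: "\<xi> \<in> ?X"
    show "psd (alpha (M \<xi>) - alpha (M \<xi>s))"
    proof (rule alpha_antimono)
      show "pos_def (M \<xi>)"
        using \<xi> by (rule pdX)
      show "pos_def (M \<xi>s)"
        using pos(2) by (rule pd)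
      show "x \<bullet> (M \<xi> *v x) \<le> x \<bullet> (M \<xi>s *v x)" for x
        unfolding M_def using \<xi> by (intro cell_stiffness_mono cell_conductivity_mono) auto
    qed
  next
    fix \<xi> \<xi>' and u v :: real
    assume *: "\<xi> \<in> ?X" "\<xi>' \<in> ?X" "0 \<le> u" "0 \<le> v" "u + v = 1"
    then have "u *\<^sub>R \<xi> + v *\<^sub>R \<xi>' \<in> ?X"
      using X convexD by blast
    from pdX[OF this] have "pos_def (u *\<^sub>R M \<xi> + v *\<^sub>R M \<xi>')"
      by (simp only: affine[OF *(5)])
    with * have "psd (u *\<^sub>R alpha (M \<xi>) + v *\<^sub>R alpha (M \<xi>') - alpha (u *\<^sub>R M \<xi> + v *\<^sub>R M \<xi>'))"
      by (intro alpha_convex pdX)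
    moreover have "u *\<^sub>R alpha (M \<xi>s) + v *\<^sub>R alpha (M \<xi>s) = alpha (M \<xi>s)"
      using *(5) by (metis scaleR_add_left scaleR_one)
    ultimately show "psd (u *\<^sub>R (alpha (M \<xi>) - alpha (M \<xi>s)) + v *\<^sub>R (alpha (M \<xi>') - alpha (M \<xi>s))
        - (alpha (M (u *\<^sub>R \<xi> + v *\<^sub>R \<xi>')) - alpha (M \<xi>s)))"
      by (simp add: affine[OF *(5)] scaleR_diff_right algebra_simps)
  qed
  then show ?thesis
    by (simp add: misfit)
qed

end

theorem theorem7p2:
  fixes \<Omega> :: "plane set" and g :: "real \<Rightarrow> plane"
    and K :: "'t::finite \<Rightarrow> plane set" and p :: "'v::finite \<Rightarrow> plane"
    and \<psi> :: "'v \<Rightarrow> plane \<Rightarrow> real"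
    and d :: "'n::finite \<Rightarrow> 't" and e :: "'e::finite \<Rightarrow> 't \<times> 't"
    and E :: "'l::finite \<Rightarrow> plane set" and z :: "'l \<Rightarrow> real"
    and \<E> :: "'m::finite \<Rightarrow> real ^ 'l"
    and \<sigma>0 \<omega> \<beta> \<eta> :: real and th0 :: "real ^ 'e"
    and \<xi>s :: "real ^ 'n" and b :: "real ^ ('m \<times> 'l)"
    and F :: "real ^ 'n \<Rightarrow> real ^ ('m \<times> 'l)" and Ld :: "real ^ 'e ^ 'n"
  assumes "F = forward_map \<Omega> g E z \<psi> \<E> K d \<sigma>0"
    and "Ld = pinv_full_rank (increment_matrix d e)"
    and "polygonal_domain \<Omega> g"
    and "conforming_mesh \<Omega> K p"
    and "lagrange_basis K p \<psi>"
    and "inj d" and "CARD('n) < CARD('t)" and "inclusion_region K d \<subseteq> \<Omega>"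
    and "oriented_edges K d e"
    and "CARD('l) \<ge> 2" and "electrodes g E" and "\<forall>l. z l > 0"
    and "orthonormal_basis_mean_free \<E>"
    and "\<sigma>0 > 0"
    and "\<forall>\<nu>. \<sigma>0 + \<xi>s $ \<nu> > 0" and "b = F \<xi>s"
    and "\<omega> > 0" and "\<forall>j. th0 $ j > 0"
    and "\<beta> > 3 / 2" and "\<eta> = \<beta> - 3 / 2"
  shows "convex_on
           {(\<zeta>, \<theta>). (\<forall>j. \<theta> $ j > 0) \<and>
              (\<forall>\<nu>. - \<sigma>0 < (Ld *v \<zeta>) $ \<nu> \<and> (Ld *v \<zeta>) $ \<nu> \<le> \<xi>s $ \<nu>)}
           (gibbs_energy \<omega> b F Ld \<eta> th0)"
    (is "convex_on ?S _")
proof -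
  interpret cem_discretization \<Omega> g K p \<psi> E z \<E>
    by unfold_locales (use assms in auto)
  let ?X = "{\<xi>. \<forall>\<mu>. - \<sigma>0 < \<xi> $ \<mu> \<and> \<xi> $ \<mu> \<le> \<xi>s $ \<mu>}"
  have misfit: "convex_on ?X (\<lambda>\<xi>. (norm (b - F \<xi>))\<^sup>2)"
    unfolding assms(1) assms(16) using assms by (intro convex_on_misfit) auto
  have lin: "linear (\<lambda>y :: (real ^ 'e) \<times> (real ^ 'e). Ld *v fst y)"
    by (rule linear_compose[OF linear_fst matrix_vector_mul_linear, unfolded o_def])
  have lin_j: "linear (\<lambda>y :: (real ^ 'e) \<times> (real ^ 'e). snd y $ j)" for j
    by (rule linearI) auto
  have S: "convex ?S"
  proof -
    have "?S = ((\<lambda>y. Ld *v fst y) -` ?X) \<inter> (\<Inter>j. (\<lambda>y. snd y $ j) -` {0<..})"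
      by auto
    moreover have "convex ((\<lambda>y :: (real ^ 'e) \<times> (real ^ 'e). Ld *v fst y) -` ?X)"
      by (rule convex_linear_vimage[OF lin convex_on_imp_convex[OF misfit]])
    moreover have "convex (\<Inter>j. (\<lambda>y :: (real ^ 'e) \<times> (real ^ 'e). snd y $ j) -` {0<..})"
      by (intro convex_INT convex_linear_vimage lin_j convex_real_interval)
    ultimately show ?thesis
      by (simp only: convex_Int)
  qed
  have 1: "convex_on ?S (\<lambda>y. (norm (b - F (Ld *v fst y)))\<^sup>2)"
    by (rule convex_on_compose_linear[OF lin misfit S]) auto
  have 2: "convex_on ?S (\<lambda>y. (fst y $ j)\<^sup>2 / snd y $ j)" for j
    using convex_on_square_quotient[OF S, of j] by (auto simp: split_def)
  have 3: "convex_on ?S (\<lambda>y. snd y $ j / th0 $ j)" for j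
  proof (rule convex_on_compose_linear[OF lin_j _ S])
    show "convex_on UNIV (\<lambda>t. t / th0 $ j)"
      using assms(18) by (intro convex_on_cdiv) (auto simp: convex_on_ident less_imp_le)
  qed auto
  have 4: "convex_on ?S (\<lambda>y. - ln (snd y $ j / th0 $ j))" for j
    by (rule convex_on_compose_linear[OF lin_j convex_on_minus_ln_scaled S]) (use assms(18) in auto)
  have "convex_on ?S (\<lambda>y. 1 / (2 * \<omega>\<^sup>2) * (norm (b - F (Ld *v fst y)))\<^sup>2
      + 1 / 2 * (\<Sum>j\<in>UNIV. (fst y $ j)\<^sup>2 / snd y $ j)
      + (\<Sum>j\<in>UNIV. snd y $ j / th0 $ j)
      + \<eta> * (\<Sum>j\<in>UNIV. - ln (snd y $ j / th0 $ j)))"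
    using assms(19,20) S by (intro convex_on_add convex_on_cmul convex_on_finite_sum 1 2 3 4) auto
  then show ?thesis
    by (simp add: gibbs_energy_def split_def sum_negf)
qed

end
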